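(* Let $n\ge 1$ and let $M$ be an $n\times n$ matrix over $\mathbb{FT}$ that is von Neumann regular, i.e. $MBM = M$ for some $n\times n$ matrix $B$ over $\mathbb{FT}$ (for example, $M$ may be idempotent, $M^2=M$). Then the row generator rank, column generator rank, tropical rank, factor rank (also called Barvinok rank or Schein rank), Gondran-Minoux row rank, Gondran-Minoux column rank, determinantal rank and Kapranov rank of $M$ are all equal.
   Context: $\mathbb{FT}$ is the finitary tropical semiring: the set $\mathbb{R}$ with $a \oplus b = \max(a,b)$ and $a \otimes b = ab = a+b$. $\mathbb{T} = \mathbb{FT}\cup\{-\infty\}$ with the operations extended so that $-\infty$ is an additive identity and a multiplicative zero. Matrices multiply by $(AB)_{ij} = \bigoplus_k A_{ik}\otimes B_{kj}$; vectors are added by componentwise maximum and scaled by $(\lambda x)_i = \lambda + x_i$. The column space (row space) of a matrix over $\mathbb{FT}$ is the set of vectors generated by its columns (rows) under $\oplus$ and scaling by $\mathbb{FT}$. The generator dimension of such a space is the minimal cardinality of a generating set under $\oplus$ and scaling. For an $n\times n$ matrix $M$ over $\mathbb{FT}$: - The row (column) generator rank is the generator dimension of the row (column) space of $M$. - The tropical rank is the topological dimension of the row space of $M$, as a subset of $\mathbb{R}^n$ with the usual topology. - The factor rank is the least $k$ such that $M = BC$ with $B$ an $n\times k$ matrix and $C$ a $k\times n$ matrix over $\mathbb{FT}$. - A finite family of vectors $m_1,\dots,m_k$ is Gondran-Minoux dependent if there are disjoint sets $I,J$ with $I\cup J = \{1,\dots,k\}$ and scalars $\alpha_1,\dots,\alpha_k\in\mathbb{T}$,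 not all $-\infty$, such that $\bigoplus_{i\in I}\alpha_i m_i = \bigoplus_{j\in J}\alpha_j m_j$ (an empty sum being the vector with all entries $-\infty$); otherwise it is Gondran-Minoux independent. The Gondran-Minoux row (column) rank is the maximal number of rows (columns) of $M$ forming a Gondran-Minoux independent family. - The determinantal rank is the largest $k$ such that $M$ has a $k\times k$ submatrix $A$ with $\bigoplus_{\sigma\text{ even}}\bigotimes_{i=1}^k A_{i\sigma(i)} \neq \bigoplus_{\sigma\text{ odd}}\bigotimes_{i=1}^k A_{i\sigma(i)}$, where $\sigma$ ranges over even, respectively odd, permutations of $\{1,\dots,k\}$ (an empty sum being $-\infty$). - Let $K$ be the field of formal power series $c_1t^{a_1}+c_2t^{a_2}+\cdots$ with complex coefficients and real exponents $a_1<a_2<\cdots$ having no accumulation point, and for $0\ne f\in K$ let $\operatorname{val}(f)$ be its smallest exponent with non-zero coefficient. The Kapranov rank of $M$ is the smallest rank of an $n\times n$ matrix $F$ over $K$ with all entries non-zero and $-\operatorname{val}(F_{ij}) = M_{ij}$ for all $i,j$. *)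

theory Defs
  imports "HOL-Analysis.Analysis" "HOL-Combinatorics.Permutations"
begin

section \<open>Power series with real exponents\<close>

text \<open>
  A series is represented by its coefficient function. For a set of reals it is equivalent that it
  can be listed as a finite or infinite sequence \<open>a\<^sub>1 < a\<^sub>2 < \<dots>\<close> without accumulation point, and
  that it has only finitely many elements below any given bound.
\<close>

typedef pseries = "{f :: real \<Rightarrow> complex. \<forall>x. finite {a. a \<le> x \<and> f a \<noteq> 0}}"
  morphisms coeff Abs_pseries
  by (rule exI[of _ "\<lambda>_. 0"]) simp

setup_lifting type_definition_pseries

lemma finite_coeff: "finite {a. a \<le> x \<and> coeff f a \<noteq> 0}"
  using coeff[of f] by auto

lemma coeff_lower_bound: "\<exists>L. \<forall>a. coeff f a \<noteq> 0 \<longrightarrow> L \<le> a"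
proof -
  let ?A = "insert 0 {a. a \<le> 0 \<and> coeff f a \<noteq> 0}"
  have fin: "finite ?A"
    using finite_coeff[of 0 f] by simp
  have "Min ?A \<le> a" if "coeff f a \<noteq> 0" for a
  proof (cases "a \<le> 0")
    case True
    then show ?thesis
      using that fin by (intro Min_le) auto
  next
    case False
    have "Min ?A \<le> 0"
      using fin by (intro Min_le) auto
    with False show ?thesis
      by linarith
  qed
  then show ?thesis
    by blast
qed

lemma coeff_exponent_pairs:
  fixes f g :: pseries and x :: real
  obtains A B where "finite A" "finite B"
    "\<And>a b. coeff f a \<noteq> 0 \<Longrightarrow> coeff g b \<noteq> 0 \<Longrightarrow> a + b \<le> x \<Longrightarrow> a \<in> A \<and> b \<in> B"
proof -
  obtain K where K: "\<And>a. coeff f a \<noteq> 0 \<Longrightarrow> K \<le> a"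
    using coeff_lower_bound by blast
  obtain L where L: "\<And>a. coeff g a \<noteq> 0 \<Longrightarrow> L \<le> a"
    using coeff_lower_bound by blast
  show ?thesis
  proof
    show "finite {a. a \<le> x - L \<and> coeff f a \<noteq> 0}" "finite {b. b \<le> x - K \<and> coeff g b \<noteq> 0}"
      by (rule finite_coeff)+
    fix a b assume "coeff f a \<noteq> 0" "coeff g b \<noteq> 0" "a + b \<le> x"
    then show "a \<in> {a. a \<le> x - L \<and> coeff f a \<noteq> 0} \<and> b \<in> {b. b \<le> x - K \<and> coeff g b \<noteq> 0}"
      using K[of a] L[of b] by auto
  qed
qed

instantiation pseries :: "{zero, one, plus, uminus, minus, times}"
begin

lift_definition zero_pseries :: pseries is "\<lambda>_. 0" by simp

lift_definition one_pseries :: pseries is "\<lambda>a. if a = 0 then 1 else 0"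
  by (auto intro: finite_subset[of _ "{0}"])

lift_definition plus_pseries :: "pseries \<Rightarrow> pseries \<Rightarrow> pseries" is "\<lambda>f g a. f a + g a"
proof -
  fix f g :: "real \<Rightarrow> complex" and x
  assume "\<And>x. finite {a. a \<le> x \<and> f a \<noteq> 0}" "\<And>x. finite {a. a \<le> x \<and> g a \<noteq> 0}"
  then have "finite ({a. a \<le> x \<and> f a \<noteq> 0} \<union> {a. a \<le> x \<and> g a \<noteq> 0})"
    by simp
  then show "finite {a. a \<le> x \<and> f a + g a \<noteq> 0}"
    by (rule rev_finite_subset) auto
qed

lift_definition uminus_pseries :: "pseries \<Rightarrow> pseries" is "\<lambda>f a. - f a" by simp

definition minus_pseries :: "pseries \<Rightarrow> pseries \<Rightarrow> pseries" where
  "minus_pseries f g = f + - g"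

text \<open>The sum is finite because both supports are bounded below.\<close>

definition times_pseries :: "pseries \<Rightarrow> pseries \<Rightarrow> pseries" where
  "times_pseries f g =
    Abs_pseries (\<lambda>c. \<Sum>a | coeff f a \<noteq> 0 \<and> coeff g (c - a) \<noteq> 0. coeff f a * coeff g (c - a))"

instance ..

end

lemma pseries_eqI: "(\<And>a. coeff f a = coeff g a) \<Longrightarrow> f = g"
  by (simp add: coeff_inject[symmetric] ext)

lemma coeff_Abs_pseries:
  "(\<And>x. finite {a. a \<le> x \<and> f a \<noteq> 0}) \<Longrightarrow> coeff (Abs_pseries f) = f"
  by (simp add: Abs_pseries_inverse)

lemma coeff_minus: "coeff (f - g) a = coeff f a - coeff g a"
  by (simp add: minus_pseries_def plus_pseries.rep_eq uminus_pseries.rep_eq)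

lemmas coeff_simps =
  zero_pseries.rep_eq one_pseries.rep_eq plus_pseries.rep_eq uminus_pseries.rep_eq coeff_minus

lemma coeff_times:
  "coeff (f * g) c = (\<Sum>a | coeff f a \<noteq> 0 \<and> coeff g (c - a) \<noteq> 0. coeff f a * coeff g (c - a))"
proof -
  let ?h = "\<lambda>c. \<Sum>a | coeff f a \<noteq> 0 \<and> coeff g (c - a) \<noteq> 0. coeff f a * coeff g (c - a)"
  have "finite {c. c \<le> x \<and> ?h c \<noteq> 0}" for x
  proof -
    obtain A B where AB: "finite A" "finite B"
      "\<And>a b. coeff f a \<noteq> 0 \<Longrightarrow> coeff g b \<noteq> 0 \<Longrightarrow> a + b \<le> x \<Longrightarrow> a \<in> A \<and> b \<in> B"
      using coeff_exponent_pairs[of f g x] by metis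
    have "{c. c \<le> x \<and> ?h c \<noteq> 0} \<subseteq> (\<lambda>(a, b). a + b) ` (A \<times> B)"
    proof
      fix c assume c: "c \<in> {c. c \<le> x \<and> ?h c \<noteq> 0}"
      then obtain a where "coeff f a \<noteq> 0" "coeff g (c - a) \<noteq> 0"
        by (auto elim!: sum.not_neutral_contains_not_neutral)
      moreover from this have "a \<in> A \<and> c - a \<in> B"
        using c by (intro AB(3)) auto
      ultimately show "c \<in> (\<lambda>(a, b). a + b) ` (A \<times> B)"
        by (intro image_eqI[of _ _ "(a, c - a)"]) auto
    qed
    then show ?thesis
      by (rule finite_subset) (use AB in auto)
  qed
  then show ?thesis
    unfolding times_pseries_def by (subst coeff_Abs_pseries) auto
qed

lemma coeff_times_superset:
  assumes "finite A" "\<And>a. coeff f a \<noteq> 0 \<Longrightarrow> coeff g (c - a) \<noteq> 0 \<Longrightarrow> a \<in> A"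
  shows "coeff (f * g) c = (\<Sum>a\<in>A. coeff f a * coeff g (c - a))"
  unfolding coeff_times by (rule sum.mono_neutral_left) (use assms in auto)

lemma finite_times_support: "finite {a. coeff f a \<noteq> 0 \<and> coeff g (c - a) \<noteq> 0}"
proof -
  obtain A B where AB: "finite A" "finite B"
    "\<And>a b. coeff f a \<noteq> 0 \<Longrightarrow> coeff g b \<noteq> 0 \<Longrightarrow> a + b \<le> c \<Longrightarrow> a \<in> A \<and> b \<in> B"
    using coeff_exponent_pairs[of f g c] by metis
  show ?thesis
    by (rule finite_subset[OF _ AB(1)]) (use AB(3) in force)
qed

lemma pseries_mult_commute: "f * g = g * (f :: pseries)"
proof (rule pseries_eqI)
  fix c
  show "coeff (f * g) c = coeff (g * f) c"
    unfolding coeff_times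
    by (rule sum.reindex_bij_witness[of _ "\<lambda>a. c - a" "\<lambda>a. c - a"]) auto
qed

lemma pseries_mult_assoc: "(f * g) * h = f * (g * (h :: pseries))"
proof (rule pseries_eqI)
  fix d
  obtain K where K: "\<And>a. coeff f a \<noteq> 0 \<Longrightarrow> K \<le> a"
    using coeff_lower_bound by blast
  obtain L where L: "\<And>a. coeff g a \<noteq> 0 \<Longrightarrow> L \<le> a"
    using coeff_lower_bound by blast
  obtain N where N: "\<And>a. coeff h a \<noteq> 0 \<Longrightarrow> N \<le> a"
    using coeff_lower_bound by blast
  define A where "A = {a. a \<le> d - L - N \<and> coeff f a \<noteq> 0}"
  define B where "B = {b. b \<le> d - K - N \<and> coeff g b \<noteq> 0}"
  define S where "S = (\<lambda>(a, b). a + b) ` (A \<times> B)"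
  have fin: "finite A" "finite B" "finite S"
    unfolding A_def B_def S_def by (auto intro!: finite_imageI finite_coeff)
  have triple: "a \<in> A \<and> b \<in> B"
    if "coeff f a \<noteq> 0" "coeff g b \<noteq> 0" "coeff h (d - a - b) \<noteq> 0" for a b
    using that K[of a] L[of b] N[of "d - a - b"] unfolding A_def B_def by auto
  have nz: "\<exists>b. coeff u b \<noteq> 0 \<and> coeff v (c - b) \<noteq> 0" if "coeff (u * v) c \<noteq> 0" for u v c
    using that unfolding coeff_times by (auto elim!: sum.not_neutral_contains_not_neutral)
  have "coeff ((f * g) * h) d = (\<Sum>s\<in>S. coeff (f * g) s * coeff h (d - s))"
  proof (rule coeff_times_superset[OF fin(3)])
    fix s assume "coeff (f * g) s \<noteq> 0" and s: "coeff h (d - s) \<noteq> 0"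
    then obtain a where a: "coeff f a \<noteq> 0" "coeff g (s - a) \<noteq> 0"
      using nz by blast
    then have "a \<in> A \<and> s - a \<in> B"
      using s by (intro triple) auto
    then show "s \<in> S"
      unfolding S_def by (intro image_eqI[of _ _ "(a, s - a)"]) auto
  qed
  also have "\<dots> = (\<Sum>s\<in>S. \<Sum>a\<in>A. coeff f a * coeff g (s - a) * coeff h (d - s))"
  proof (rule sum.cong[OF refl])
    fix s assume "s \<in> S"
    show "coeff (f * g) s * coeff h (d - s)
        = (\<Sum>a\<in>A. coeff f a * coeff g (s - a) * coeff h (d - s))"
    proof (cases "coeff h (d - s) = 0")
      case False
      have "a \<in> A" if "coeff f a \<noteq> 0" "coeff g (s - a) \<noteq> 0" for a
        using triple[OF that] False by simp
      then show ?thesis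
        by (subst coeff_times_superset[OF fin(1)]) (auto simp: sum_distrib_right)
    qed simp
  qed
  also have "\<dots> = (\<Sum>a\<in>A. \<Sum>s\<in>S. coeff f a * coeff g (s - a) * coeff h (d - s))"
    by (rule sum.swap)
  also have "\<dots> = (\<Sum>a\<in>A. coeff f a * coeff (g * h) (d - a))"
  proof (rule sum.cong[OF refl])
    fix a assume a: "a \<in> A"
    have "coeff (g * h) (d - a)
        = (\<Sum>b\<in>(\<lambda>s. s - a) ` S. coeff g b * coeff h (d - a - b))"
    proof (rule coeff_times_superset)
      fix b assume "coeff g b \<noteq> 0" "coeff h (d - a - b) \<noteq> 0"
      then have "b \<in> B"
        using a triple by (auto simp: A_def)
      then show "b \<in> (\<lambda>s. s - a) ` S"
        using a unfolding S_def by (intro image_eqI[of _ _ "a + b"]) auto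
    qed (use fin in auto)
    also have "\<dots> = (\<Sum>s\<in>S. coeff g (s - a) * coeff h (d - s))"
      by (subst sum.reindex) (auto simp: inj_on_def)
    finally show "(\<Sum>s\<in>S. coeff f a * coeff g (s - a) * coeff h (d - s))
        = coeff f a * coeff (g * h) (d - a)"
      by (simp add: sum_distrib_left mult.assoc)
  qed
  also have "\<dots> = coeff (f * (g * h)) d"
  proof (rule coeff_times_superset[OF fin(1), symmetric])
    fix a assume a: "coeff f a \<noteq> 0" "coeff (g * h) (d - a) \<noteq> 0"
    then obtain b where "coeff g b \<noteq> 0" "coeff h (d - a - b) \<noteq> 0"
      using nz by blast
    then show "a \<in> A"
      using a triple by blast
  qed
  finally show "coeff ((f * g) * h) d = coeff (f * (g * h)) d" .
qed

lemma pseries_distrib_right: "(f + g) * h = f * h + g * (h :: pseries)"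
proof (rule pseries_eqI)
  fix c
  let ?A = "{a. coeff f a \<noteq> 0 \<and> coeff h (c - a) \<noteq> 0} \<union> {a. coeff g a \<noteq> 0 \<and> coeff h (c - a) \<noteq> 0}"
  have fin: "finite ?A"
    by (simp add: finite_times_support)
  have "coeff ((f + g) * h) c = (\<Sum>a\<in>?A. coeff (f + g) a * coeff h (c - a))"
    by (rule coeff_times_superset[OF fin]) (auto simp: coeff_simps)
  moreover have "coeff (f * h) c = (\<Sum>a\<in>?A. coeff f a * coeff h (c - a))"
    by (rule coeff_times_superset[OF fin]) auto
  moreover have "coeff (g * h) c = (\<Sum>a\<in>?A. coeff g a * coeff h (c - a))"
    by (rule coeff_times_superset[OF fin]) auto
  ultimately show "coeff ((f + g) * h) c = coeff (f * h + g * h) c"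
    by (simp add: coeff_simps distrib_right sum.distrib)
qed

lemma pseries_mult_1: "1 * f = (f :: pseries)"
proof (rule pseries_eqI)
  fix c
  show "coeff (1 * f) c = coeff f c"
    by (subst coeff_times_superset[of "{0}"]) (auto simp: coeff_simps split: if_splits)
qed

instance pseries :: comm_ring_1
proof
  fix f g h :: pseries
  show "f * g * h = f * (g * h)" by (rule pseries_mult_assoc)
  show "f * g = g * f" by (rule pseries_mult_commute)
  show "1 * f = f" by (rule pseries_mult_1)
  show "(f + g) * h = f * h + g * h" by (rule pseries_distrib_right)
  show "f + g + h = f + (g + h)" "f + g = g + f" "0 + f = f" "- f + f = 0" "f - g = f + - g"
    by (rule pseries_eqI; simp add: coeff_simps)+
  show "(0 :: pseries) \<noteq> 1"
  proof
    assume "(0 :: pseries) = 1"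
    then have "coeff 0 0 = coeff 1 0"
      by simp
    then show False
      by (simp add: coeff_simps)
  qed
qed

lift_definition pmonom :: "complex \<Rightarrow> real \<Rightarrow> pseries" is "\<lambda>c b a. if a = b then c else 0"
proof -
  fix c :: complex and b x :: real
  show "finite {a. a \<le> x \<and> (if a = b then c else 0) \<noteq> 0}"
    by (rule finite_subset[of _ "{b}"]) auto
qed

lemma coeff_pmonom_mult: "coeff (pmonom c b * f) a = c * coeff f (a - b)"
  by (subst coeff_times_superset[of "{b}"]) (auto simp: pmonom.rep_eq split: if_splits)

lemma coeff_cong_mult:
  assumes "\<And>a. coeff f a \<noteq> 0 \<Longrightarrow> 0 \<le> a" "\<And>a. a \<le> x \<Longrightarrow> coeff g a = coeff h a"
  shows "coeff (f * g) x = coeff (f * h) x"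
proof -
  have eq: "coeff g (x - a) = coeff h (x - a)" if "coeff f a \<noteq> 0" for a
    using assms(1)[OF that] by (intro assms(2)) simp
  show ?thesis
    unfolding coeff_times by (rule sum.cong) (use eq in auto)
qed

lemma coeff_power_eq_0:
  assumes "\<And>a. coeff u a \<noteq> 0 \<Longrightarrow> \<delta> \<le> a"
  shows "x < real n * \<delta> \<Longrightarrow> coeff (u ^ n) x = 0"
proof (induction n arbitrary: x)
  case 0
  then show ?case
    by (simp add: coeff_simps)
next
  case (Suc n)
  have "coeff u a = 0 \<or> coeff (u ^ n) (x - a) = 0" for a
    using assms[of a] Suc.IH[of "x - a"] Suc.prems by (cases "coeff u a = 0") (auto simp: algebra_simps)
  then show ?case
    unfolding power_Suc coeff_times by (intro sum.neutral) auto
qed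

lemma coeff_sum: "coeff (sum f A) a = (\<Sum>i\<in>A. coeff (f i) a)"
  by (induction A rule: infinite_finite_induct) (simp_all add: coeff_simps)

text \<open>Inversion by the geometric series.\<close>

lemma pseries_inverse_one_minus:
  assumes "\<delta> > 0" and u: "\<And>a. coeff u a \<noteq> 0 \<Longrightarrow> \<delta> \<le> a"
  shows "\<exists>g. (1 - u) * g = 1"
proof -
  define N where "N x = nat \<lceil>x / \<delta>\<rceil>" for x
  define G where "G n = (\<Sum>i\<le>n. u ^ i)" for n
  have pow0: "coeff (u ^ i) x = 0" if "x < real i * \<delta>" for i x
    using u that by (rule coeff_power_eq_0)
  have N: "x < real i * \<delta>" if "N x < i" for x i
  proof -
    have "x / \<delta> < real i"
      using that unfolding N_def by linarith
    then show ?thesis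
      using \<open>\<delta> > 0\<close> by (simp add: field_simps)
  qed
  have stable: "coeff (G n) a = coeff (G (N a)) a" if "N a \<le> n" for n a
    unfolding G_def coeff_sum
  proof (rule sum.mono_neutral_right)
    show "\<forall>i\<in>{..n} - {..N a}. coeff (u ^ i) a = 0"
    proof
      fix i assume "i \<in> {..n} - {..N a}"
      then have "a < real i * \<delta>"
        by (intro N) auto
      then show "coeff (u ^ i) a = 0"
        by (rule pow0)
    qed
  qed (use that in auto)
  have mono: "N a \<le> N x" if "a \<le> x" for a x
  proof -
    have "a / \<delta> \<le> x / \<delta>"
      using that \<open>\<delta> > 0\<close> by (intro divide_right_mono) auto
    then show ?thesis
      unfolding N_def by linarith
  qed
  define g where "g = Abs_pseries (\<lambda>x. coeff (G (N x)) x)"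
  have g: "coeff g a = coeff (G (N a)) a" for a
  proof -
    have "finite {a. a \<le> x \<and> coeff (G (N a)) a \<noteq> 0}" for x
    proof (rule finite_subset[OF _ finite_coeff[of x "G (N x)"]])
      show "{a. a \<le> x \<and> coeff (G (N a)) a \<noteq> 0} \<subseteq> {a. a \<le> x \<and> coeff (G (N x)) a \<noteq> 0}"
      proof
        fix a assume a: "a \<in> {a. a \<le> x \<and> coeff (G (N a)) a \<noteq> 0}"
        then have "coeff (G (N x)) a = coeff (G (N a)) a"
          by (intro stable mono) simp
        with a show "a \<in> {a. a \<le> x \<and> coeff (G (N x)) a \<noteq> 0}"
          by auto
      qed
    qed
    then show ?thesis
      unfolding g_def by (subst coeff_Abs_pseries) auto
  qed
  have "(1 - u) * g = 1"
  proof (rule pseries_eqI)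
    fix x
    have "coeff ((1 - u) * g) x = coeff ((1 - u) * G (N x)) x"
    proof (rule coeff_cong_mult)
      fix a assume "coeff (1 - u) a \<noteq> 0"
      then show "0 \<le> a"
        using u[of a] \<open>\<delta> > 0\<close> by (auto simp: coeff_simps split: if_splits)
    next
      fix a assume "a \<le> x"
      then show "coeff g a = coeff (G (N x)) a"
        using trans[OF g stable[OF mono, symmetric]] by blast
    qed
    also have "(1 - u) * G (N x) = 1 - u ^ Suc (N x)"
      unfolding G_def by (metis one_diff_power_eq lessThan_Suc_atMost)
    also have "coeff (1 - u ^ Suc (N x)) x = coeff 1 x"
      using pow0[OF N, of x "Suc (N x)"] by (simp add: coeff_minus)
    finally show "coeff ((1 - u) * g) x = coeff 1 x" .
  qed
  then show ?thesis ..
qed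

lemma coeff_least_exponent:
  assumes "f \<noteq> 0"
  obtains b where "coeff f b \<noteq> 0" "\<And>a. coeff f a \<noteq> 0 \<Longrightarrow> b \<le> a"
proof -
  obtain x where x: "coeff f x \<noteq> 0"
    using assms pseries_eqI[of f 0] by (auto simp: coeff_simps)
  let ?A = "{a. a \<le> x \<and> coeff f a \<noteq> 0}"
  have A: "finite ?A" "x \<in> ?A"
    using finite_coeff x by auto
  have "Min ?A \<in> ?A"
    using A by (intro Min_in) auto
  moreover have "Min ?A \<le> a" if "coeff f a \<noteq> 0" for a
  proof (cases "a \<le> x")
    case True
    then show ?thesis
      using that A by (intro Min_le) auto
  next
    case False
    have "Min ?A \<le> x"
      using A by (intro Min_le) auto
    with False show ?thesis
      by linarith
  qed
  ultimately show ?thesis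
    using that by blast
qed

lemma pseries_inverse_exists:
  assumes "f \<noteq> (0 :: pseries)"
  shows "\<exists>g. f * g = 1"
proof -
  obtain b where b: "coeff f b \<noteq> 0" "\<And>a. coeff f a \<noteq> 0 \<Longrightarrow> b \<le> a"
    using coeff_least_exponent[OF assms] by blast
  define m where "m = pmonom (1 / coeff f b) (- b)"
  define u where "u = 1 - m * f"
  have mf: "coeff (m * f) a = coeff f (a + b) / coeff f b" for a
    unfolding m_def coeff_pmonom_mult by simp
  have pos: "0 < a" if "coeff u a \<noteq> 0" for a
  proof -
    have "a \<noteq> 0" "coeff f (a + b) \<noteq> 0"
      using that b(1) unfolding u_def by (auto simp: coeff_simps mf split: if_splits)
    then show ?thesis
      using b(2)[of "a + b"] by auto
  qed
  obtain \<delta> where "\<delta> > 0" and \<delta>: "\<And>a. coeff u a \<noteq> 0 \<Longrightarrow> \<delta> \<le> a"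
  proof (cases "u = 0")
    case True
    then show ?thesis
      by (intro that[of 1]) (simp_all add: coeff_simps)
  next
    case False
    then obtain e where e: "coeff u e \<noteq> 0" "\<And>a. coeff u a \<noteq> 0 \<Longrightarrow> e \<le> a"
      using coeff_least_exponent by blast
    show ?thesis
      using pos[OF e(1)] e(2) by (rule that)
  qed
  then obtain g where "(1 - u) * g = 1"
    using pseries_inverse_one_minus[of \<delta> u] by blast
  then have "m * f * g = 1"
    unfolding u_def by simp
  then have "f * (m * g) = 1"
    by (simp only: mult.assoc mult.left_commute[of f m g])
  then show ?thesis ..
qed

instantiation pseries :: field
begin

definition inverse_pseries :: "pseries \<Rightarrow> pseries" where
  "inverse_pseries f = (if f = 0 then 0 else (SOME g. f * g = 1))"

definition divide_pseries :: "pseries \<Rightarrow> pseries \<Rightarrow> pseries" where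
  "divide_pseries f g = f * inverse g"

instance
proof
  fix f g :: pseries
  show "inverse f * f = 1" if "f \<noteq> 0"
  proof -
    have "f * (SOME g. f * g = 1) = 1"
      by (rule someI_ex) (rule pseries_inverse_exists[OF that])
    then show ?thesis
      using that unfolding inverse_pseries_def by (simp only: if_False mult.commute)
  qed
  show "f div g = f * inverse g"
    by (rule divide_pseries_def)
  show "inverse (0 :: pseries) = 0"
    by (simp add: inverse_pseries_def)
qed

end

definition val :: "pseries \<Rightarrow> real" where
  "val f = (LEAST a. coeff f a \<noteq> 0)"


section \<open>Tropical matrices and spaces\<close>

definition trop_mult :: "real^'n^'n \<Rightarrow> real^'n^'n \<Rightarrow> real^'n^'n" (infixl "\<otimes>\<^sub>T" 70) where
  "A \<otimes>\<^sub>T B = (\<chi> i j. MAX k\<in>UNIV. A $ i $ k + B $ k $ j)"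

definition von_neumann_regular :: "real^'n^'n \<Rightarrow> bool" where
  "von_neumann_regular M \<longleftrightarrow> (\<exists>B. M \<otimes>\<^sub>T B \<otimes>\<^sub>T M = M)"

inductive_set trop_span :: "(real^'n) set \<Rightarrow> (real^'n) set" for G where
  gen: "x \<in> G \<Longrightarrow> x \<in> trop_span G"
| add: "x \<in> trop_span G \<Longrightarrow> y \<in> trop_span G \<Longrightarrow> (\<chi> i. max (x $ i) (y $ i)) \<in> trop_span G"
| scale: "x \<in> trop_span G \<Longrightarrow> (\<chi> i. c + x $ i) \<in> trop_span G"

definition row_space :: "real^'n^'n \<Rightarrow> (real^'n) set" where
  "row_space M = trop_span (rows M)"

definition column_space :: "real^'n^'n \<Rightarrow> (real^'n) set" where
  "column_space M = trop_span (columns M)"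

definition generator_dimension :: "(real^'n) set \<Rightarrow> nat" where
  "generator_dimension V = (LEAST k. \<exists>G. finite G \<and> card G = k \<and> trop_span G = V)"


section \<open>Ranks of tropical matrices\<close>

definition row_generator_rank :: "real^'n^'n \<Rightarrow> nat" where
  "row_generator_rank M = generator_dimension (row_space M)"

definition column_generator_rank :: "real^'n^'n \<Rightarrow> nat" where
  "column_generator_rank M = generator_dimension (column_space M)"

text \<open>
  The relation \<open>dim_le\<close> bounds the small inductive dimension; on separable metrizable spaces, in
  particular on subsets of Euclidean space, the small inductive, large inductive and covering
  dimensions coincide. Row spaces are non-empty, so their dimension is a natural number.
\<close>

definition tropical_rank :: "real^'n^'n \<Rightarrow> nat" where
  "tropical_rank M = (LEAST d. top_of_set (row_space M) dim_le int d)"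

text \<open>
  \<open>B\<close> and \<open>C\<close> have inner index range \<open>{..<k}\<close>. The case \<open>k = 0\<close> is excluded because the product
  would then have all entries \<open>-\<infinity>\<close>, while \<open>Max {}\<close> is an unspecified real number.
\<close>

definition factor_rank :: "real^'n^'n \<Rightarrow> nat" where
  "factor_rank M = (LEAST k. k > 0 \<and>
     (\<exists>(B :: 'n \<Rightarrow> nat \<Rightarrow> real) (C :: nat \<Rightarrow> 'n \<Rightarrow> real).
        \<forall>i j. M $ i $ j = (MAX l\<in>{..<k}. B i l + C l j)))"

text \<open>
  The extended tropical semiring is the set of extended reals other than \<open>\<infinity>\<close>. Suprema in type
  \<^typ>\<open>ereal\<close> over finite index sets are maxima, and the empty one is \<open>-\<infinity>\<close>.
  The vectors form a family indexed by \<open>S\<close>, so equal vectors with different indices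
  are counted separately.
\<close>

definition gondran_minoux_dependent :: "'i set \<Rightarrow> ('i \<Rightarrow> real^'n) \<Rightarrow> bool" where
  "gondran_minoux_dependent S m \<longleftrightarrow>
     (\<exists>I J (\<alpha> :: 'i \<Rightarrow> ereal). I \<inter> J = {} \<and> I \<union> J = S \<and>
        (\<forall>i\<in>S. \<alpha> i \<noteq> \<infinity>) \<and> (\<exists>i\<in>S. \<alpha> i \<noteq> -\<infinity>) \<and>
        (\<forall>c. (SUP i\<in>I. \<alpha> i + ereal (m i $ c)) = (SUP j\<in>J. \<alpha> j + ereal (m j $ c))))"

definition gondran_minoux_row_rank :: "real^'n^'n \<Rightarrow> nat" where
  "gondran_minoux_row_rank M = Max {card S | S. \<not> gondran_minoux_dependent S (\<lambda>i. row i M)}"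

definition gondran_minoux_column_rank :: "real^'n^'n \<Rightarrow> nat" where
  "gondran_minoux_column_rank M = Max {card S | S. \<not> gondran_minoux_dependent S (\<lambda>j. column j M)}"

definition trop_even_sum :: "nat \<Rightarrow> (nat \<Rightarrow> nat \<Rightarrow> real) \<Rightarrow> ereal" where
  "trop_even_sum k A = (SUP \<sigma>\<in>{\<sigma>. \<sigma> permutes {..<k} \<and> evenperm \<sigma>}. ereal (\<Sum>i<k. A i (\<sigma> i)))"

definition trop_odd_sum :: "nat \<Rightarrow> (nat \<Rightarrow> nat \<Rightarrow> real) \<Rightarrow> ereal" where
  "trop_odd_sum k A = (SUP \<sigma>\<in>{\<sigma>. \<sigma> permutes {..<k} \<and> \<not> evenperm \<sigma>}. ereal (\<Sum>i<k. A i (\<sigma> i)))"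

text \<open>
  The index type carries no order, so a \<open>k\<close> by \<open>k\<close> submatrix is given by listing \<open>k\<close> distinct
  row indices \<open>r\<close> and \<open>k\<close> distinct column indices \<open>c\<close>. Reordering either list at most exchanges
  the two sums.
\<close>

definition determinantal_rank :: "real^'n^'n \<Rightarrow> nat" where
  "determinantal_rank M = Max {k. \<exists>(r :: nat \<Rightarrow> 'n) (c :: nat \<Rightarrow> 'n).
     inj_on r {..<k} \<and> inj_on c {..<k} \<and>
     trop_even_sum k (\<lambda>i j. M $ r i $ c j) \<noteq> trop_odd_sum k (\<lambda>i j. M $ r i $ c j)}"

definition kapranov_rank :: "real^'n^'n \<Rightarrow> nat" where
  "kapranov_rank M = (LEAST k. \<exists>F :: pseries^'n^'n.
     (\<forall>i j. F $ i $ j \<noteq> 0 \<and> - val (F $ i $ j) = M $ i $ j) \<and> rank F = k)"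

end

theory Submission
  imports Defs
begin

text \<open>
  Let \<open>k\<close> be the column generator rank of \<open>M = M B M\<close>, and let \<open>g\<close> be a generating family of the
  column space with \<open>k\<close> members. Writing \<open>M = G R\<close> with \<open>G\<close> the matrix of generators, the matrix
  \<open>P = R B G\<close> satisfies \<open>G P = G\<close>. By irredundancy \<open>P j j = 0\<close>, and averaging the inequalities
  \<open>P i j \<le> g j $ s - g i $ s\<close> over \<open>s\<close> yields a potential \<open>u\<close> with \<open>P i j < u j - u i\<close> for
  \<open>i \<noteq> j\<close>. Reading off where the maxima defining \<open>P j j\<close> are attained gives a \<open>k\<close> by \<open>k\<close> minor of
  \<open>M\<close> that, up to scaling of rows and columns, is zero on the diagonal and negative elsewhere.

  Such a minor bounds the factor, Gondran-Minoux, determinantal and Kapranov ranks from below by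
  \<open>k\<close>, while the factorization through \<open>k\<close> bounds them from above. The same applies to the transpose,
  so that row and column generator rank agree. Finally \<open>x \<mapsto> R B x\<close> embeds the column space into
  \<open>k\<close>-dimensional space with inverse \<open>y \<mapsto> G y\<close>, and its image contains a ball around \<open>- u\<close>; hence
  the column space has dimension \<open>k\<close>. That a ball of dimension \<open>k\<close> does not have small inductive
  dimension below \<open>k\<close> follows from Brouwer's theorem, since maps from closed subsets of a compact
  space of smaller dimension to a punctured \<open>k\<close>-dimensional space extend to the whole space.
\<close>

section \<open>Small inductive dimension in Euclidean space\<close>

lemma frontier_of_Int_ball_subset:
  fixes S :: "'a::euclidean_space set"
  assumes "0 < e"
  shows "top_of_set S frontier_of (S \<inter> ball x e) \<subseteq> S \<inter> sphere x e"
proof -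
  have "top_of_set S frontier_of (S \<inter> ball x e) = top_of_set S frontier_of (ball x e)"
    by (metis frontier_of_restrict topspace_euclidean_subtopology)
  moreover have "S \<inter> top_of_set S frontier_of (ball x e) \<subseteq> sphere x e"
    using frontier_of_subtopology_subset[of S euclidean "ball x e"] assms by simp
  moreover have "top_of_set S frontier_of (ball x e) \<subseteq> S"
    using frontier_of_subset_topspace[of "top_of_set S"] by simp
  ultimately show ?thesis
    by auto
qed

text \<open>Induction on \<open>d\<close>: a small ball around a point \<open>x\<close> of the
  sphere has its relative frontier where two spheres meet, and such points lie in a hyperplane
  \<open>H\<close>. There they belong to a sphere in \<open>L \<inter> H\<close>, whose dimension
  bound is one less.\<close>

lemma sphere_dim_le:
  fixes L :: "'a::euclidean_space set"
  assumes "affine L" "a \<in> L" "0 < r" "aff_dim L \<le> int d"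
  shows "top_of_set (L \<inter> sphere a r) dim_le int d - 1"
  using assms
proof (induction d arbitrary: L a r)
  case 0
  then have "aff_dim L = 0"
    using aff_dim_negative_iff[of L] by fastforce
  then obtain b where "L = {b}"
    using aff_dim_eq_0 by metis
  then have "L = {a}"
    using \<open>a \<in> L\<close> by simp
  then have "L \<inter> sphere a r = {}"
    using \<open>0 < r\<close> by auto
  then show ?case
    by simp
next
  case (Suc d)
  let ?S = "L \<inter> sphere a r"
  show ?case
  proof (subst dimension_le_eq_subtopology, intro conjI allI impI)
    show "- 1 \<le> int (Suc d) - 1"
      by simp
    fix V x assume "openin euclidean V \<and> x \<in> V \<and> x \<in> ?S"
    then have "open V" "x \<in> V" "x \<in> L" and ax: "dist a x = r"
      by auto
    then obtain e' where "0 < e'" and e': "ball x e' \<subseteq> V"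
      using openE by blast
    define e where "e = min e' (r / 2)"
    have e: "0 < e" "e < r" "ball x e \<subseteq> V"
      using \<open>0 < e'\<close> e' \<open>0 < r\<close> unfolding e_def by (auto simp: subset_ball)
    \<comment> \<open>Points at distance \<open>r\<close> from \<open>a\<close> and \<open>e\<close>
      from \<open>x\<close> satisfy \<open>(x - a) \<bullet> (y - a) = t * r\<^sup>2\<close>, the
      equation of \<open>H\<close>. \<open>t > 0\<close> keeps \<open>a\<close> off
      \<open>H\<close>, so that the dimension drops; together with \<open>t < 1\<close> it makes the
      radius \<open>r'\<close> positive.\<close>
    define t where "t = 1 - e\<^sup>2 / (2 * r\<^sup>2)"
    have "e\<^sup>2 < r\<^sup>2"
      using e by (simp add: power_strict_mono)
    moreover have "0 < e\<^sup>2" "0 < r\<^sup>2"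
      using e by simp_all
    ultimately have "e\<^sup>2 < 2 * r\<^sup>2"
      by linarith
    then have t: "0 < t" "t < 1"
      using e(1) \<open>0 < r\<close> unfolding t_def by simp_all
    then have "t\<^sup>2 < 1"
      by (simp add: power_less_one_iff)
    define H where "H = {y. (x - a) \<bullet> y = t * r\<^sup>2 + (x - a) \<bullet> a}"
    define a' where "a' = a + t *\<^sub>R (x - a)"
    define r' where "r' = r * sqrt (1 - t\<^sup>2)"
    have xa: "(x - a) \<bullet> (x - a) = r\<^sup>2"
      using ax by (simp add: dist_norm norm_minus_commute power2_norm_eq_inner[symmetric])
    have "affine (L \<inter> H)"
      unfolding H_def by (intro affine_Int affine_hyperplane Suc.prems)
    moreover have "a' \<in> L \<inter> H"
    proof
      show "a' \<in> L"
        using mem_affine[OF \<open>affine L\<close> \<open>a \<in> L\<close> \<open>x \<in> L\<close>, of "1 - t" t]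
        unfolding a'_def by (simp add: algebra_simps)
      show "a' \<in> H"
        unfolding a'_def H_def using xa by (simp add: inner_add_right)
    qed
    moreover have "0 < r'"
      unfolding r'_def using \<open>0 < r\<close> \<open>t\<^sup>2 < 1\<close> by simp
    moreover have "aff_dim (L \<inter> H) \<le> int d"
    proof -
      have "a \<notin> H"
        unfolding H_def using t \<open>0 < r\<close> by simp
      then show ?thesis
        using aff_dim_affine_Int_hyperplane[OF \<open>affine L\<close>, of "x - a" "t * r\<^sup>2 + (x - a) \<bullet> a"]
          Suc.prems unfolding H_def by (auto split: if_splits)
    qed
    ultimately have IH: "top_of_set ((L \<inter> H) \<inter> sphere a' r') dim_le int d - 1"
      by (rule Suc.IH)
    have sub: "?S \<inter> sphere x e \<subseteq> (L \<inter> H) \<inter> sphere a' r'"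
    proof
      fix y assume y: "y \<in> ?S \<inter> sphere x e"
      have ya: "(y - a) \<bullet> (y - a) = r\<^sup>2"
        using y by (simp add: dist_norm norm_minus_commute power2_norm_eq_inner[symmetric])
      have "(y - x) \<bullet> (y - x) = e\<^sup>2"
        using y by (simp add: dist_norm norm_minus_commute power2_norm_eq_inner[symmetric])
      then have "((y - a) - (x - a)) \<bullet> ((y - a) - (x - a)) = e\<^sup>2"
        by simp
      then have "2 * ((x - a) \<bullet> (y - a)) = 2 * r\<^sup>2 - e\<^sup>2"
        using xa ya by (simp only: inner_diff_left[of "y - a"] inner_diff_right[of _ "y - a"]
            inner_commute[of "y - a" "x - a"])
      then have xy: "(x - a) \<bullet> (y - a) = t * r\<^sup>2"
        unfolding t_def using \<open>0 < r\<close> by (simp add: left_diff_distrib)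
      have "y - a' = (y - a) - t *\<^sub>R (x - a)"
        unfolding a'_def by simp
      then have "(y - a') \<bullet> (y - a')
          = (y - a) \<bullet> (y - a) - 2 * t * ((x - a) \<bullet> (y - a)) + t\<^sup>2 * ((x - a) \<bullet> (x - a))"
        by (simp only: inner_diff_left[of "y - a"] inner_diff_right[of _ "y - a"] inner_scaleR_left
            inner_scaleR_right inner_commute[of "y - a" "x - a"])
          (simp add: power2_eq_square algebra_simps)
      also have "\<dots> = r\<^sup>2 * (1 - t\<^sup>2)"
        by (simp only: xa ya xy) (simp add: power2_eq_square algebra_simps)
      also have "\<dots> = r'\<^sup>2"
        unfolding r'_def using \<open>t\<^sup>2 < 1\<close> by (simp add: power_mult_distrib)
      finally have "norm (y - a') = r'"
        using \<open>0 < r'\<close> by (simp add: norm_eq_sqrt_inner)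
      moreover have "y \<in> H"
        using xy unfolding H_def by (simp add: inner_diff_right)
      ultimately show "y \<in> (L \<inter> H) \<inter> sphere a' r'"
        using y by (simp add: dist_norm norm_minus_commute)
    qed
    show "\<exists>U. x \<in> U \<and> U \<subseteq> V \<and> openin euclidean U \<and>
        top_of_set (top_of_set ?S frontier_of (?S \<inter> U)) dim_le int (Suc d) - 1 - 1"
    proof (intro exI conjI)
      show "top_of_set (top_of_set ?S frontier_of (?S \<inter> ball x e)) dim_le int (Suc d) - 1 - 1"
        using dimension_le_subtopologies[OF IH
            subset_trans[OF frontier_of_Int_ball_subset[OF e(1), of ?S x] sub]] by simp
    qed (use e in auto)
  qed
qed

text \<open>Balls have relative frontiers inside spheres, which \<open>sphere_dim_le\<close>
  bounds.\<close>

lemma affine_dim_le: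
  fixes L :: "'a::euclidean_space set"
  assumes "affine L" "aff_dim L \<le> int d"
  shows "top_of_set L dim_le int d"
proof (subst dimension_le_eq_subtopology, intro conjI allI impI)
  show "- 1 \<le> int d"
    by simp
  fix V x assume "openin euclidean V \<and> x \<in> V \<and> x \<in> L"
  then obtain e where "x \<in> L" and e: "0 < e" "ball x e \<subseteq> V"
    using openE by (metis open_openin)
  show "\<exists>U. x \<in> U \<and> U \<subseteq> V \<and> openin euclidean U \<and>
      top_of_set (top_of_set L frontier_of (L \<inter> U)) dim_le int d - 1"
  proof (intro exI conjI)
    show "top_of_set (top_of_set L frontier_of (L \<inter> ball x e)) dim_le int d - 1"
      using sphere_dim_le[OF assms(1) \<open>x \<in> L\<close> e(1) assms(2)] frontier_of_Int_ball_subset[OF e(1)]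
      by (rule dimension_le_subtopologies)
  qed (use e in auto)
qed

section \<open>Extension of maps into punctured subspaces\<close>

text \<open>The extension property of classical dimension theory: for a \<open>d\<close>-dimensional
  subspace \<open>T\<close>, \<open>T - {0}\<close> is homotopy equivalent to a sphere of dimension
  \<open>d - 1\<close>. Puncturing a subspace instead of using a sphere keeps the passage to
  orthogonal complements linear.\<close>

definition punctured_extension :: "'b::real_normed_vector set \<Rightarrow> 'a::topological_space set \<Rightarrow> bool" where
  "punctured_extension T X \<longleftrightarrow>
    (\<forall>A f. closedin (top_of_set X) A \<longrightarrow> continuous_on A f \<longrightarrow> f \<in> A \<rightarrow> T - {0} \<longrightarrow>
      (\<exists>g. continuous_on X g \<and> g \<in> X \<rightarrow> T - {0} \<and> (\<forall>x\<in>A. g x = f x)))"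

lemma punctured_extensionE:
  assumes "punctured_extension T X" "closedin (top_of_set X) A" "continuous_on A f"
    "f \<in> A \<rightarrow> T - {0}"
  obtains g where "continuous_on X g" "g \<in> X \<rightarrow> T - {0}" "\<And>x. x \<in> A \<Longrightarrow> g x = f x"
proof -
  obtain g where "continuous_on X g" "g \<in> X \<rightarrow> T - {0}" "\<forall>x\<in>A. g x = f x"
    using assms(1)[unfolded punctured_extension_def, rule_format, OF assms(2-4)] by (elim exE conjE)
  then show ?thesis
    by (intro that[of g]) simp_all
qed

lemma punctured_extension_closed_subset:
  assumes "punctured_extension T X" "closedin (top_of_set X) Y"
  shows "punctured_extension T Y"
  unfolding punctured_extension_def
proof (intro allI impI)
  fix A f assume A: "closedin (top_of_set Y) A" "continuous_on A f" "f \<in> A \<rightarrow> T - {0}"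
  then have "closedin (top_of_set X) A"
    using assms(2) closedin_trans by blast
  then obtain g where "continuous_on X g" "g \<in> X \<rightarrow> T - {0}" "\<And>x. x \<in> A \<Longrightarrow> g x = f x"
    using A(2,3) by (rule punctured_extensionE[OF assms(1)]) (rule that)
  moreover have "Y \<subseteq> X"
    using assms(2) closedin_imp_subset by blast
  ultimately show "\<exists>g. continuous_on Y g \<and> g \<in> Y \<rightarrow> T - {0} \<and> (\<forall>x\<in>A. g x = f x)"
    using continuous_on_subset[of X g Y] by blast
qed

text \<open>First extend from \<open>A \<inter> X\<close> over \<open>X\<close>, paste the result
  with \<open>f\<close>, then extend the pasted map from \<open>(X \<union> A) \<inter> Y\<close>
  over \<open>Y\<close>.\<close>

lemma punctured_extension_Un:
  assumes "punctured_extension T X" "punctured_extension T Y" "closed X" "closed Y"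
  shows "punctured_extension T (X \<union> Y)"
  unfolding punctured_extension_def
proof (intro allI impI)
  fix A f assume A: "closedin (top_of_set (X \<union> Y)) A" "continuous_on A f" "f \<in> A \<rightarrow> T - {0}"
  have "closed A"
    using closedin_closed_trans[OF A(1) closed_Un[OF assms(3,4)]] .
  have "A \<subseteq> X \<union> Y"
    using A(1) by (rule closedin_imp_subset)
  have "closedin (top_of_set X) (A \<inter> X)"
    using \<open>closed A\<close> assms(3) by (intro closed_subset closed_Int) auto
  moreover have "continuous_on (A \<inter> X) f" "f \<in> A \<inter> X \<rightarrow> T - {0}"
    using A by (auto intro: continuous_on_subset)
  ultimately obtain g where g: "continuous_on X g" "g \<in> X \<rightarrow> T - {0}"
      "\<And>x. x \<in> A \<inter> X \<Longrightarrow> g x = f x"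
    by (rule punctured_extensionE[OF assms(1)]) (rule that)
  define f' where "f' x = (if x \<in> X then g x else f x)" for x
  have "continuous_on (X \<union> A) f'"
    unfolding f'_def using \<open>closed A\<close> assms(3) g(1,3) A(2)
    by (intro continuous_on_cases) auto
  have "closedin (top_of_set Y) ((X \<union> A) \<inter> Y)"
    using \<open>closed A\<close> assms(3,4) by (intro closed_subset closed_Int closed_Un) auto
  moreover have "continuous_on ((X \<union> A) \<inter> Y) f'"
    using \<open>continuous_on (X \<union> A) f'\<close>
    by (rule continuous_on_subset) auto
  moreover have "f' \<in> (X \<union> A) \<inter> Y \<rightarrow> T - {0}"
    using g(2) A(3) unfolding f'_def by (auto simp: Pi_iff)
  ultimately obtain h where h: "continuous_on Y h" "h \<in> Y \<rightarrow> T - {0}"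
      "\<And>x. x \<in> (X \<union> A) \<inter> Y \<Longrightarrow> h x = f' x"
    by (rule punctured_extensionE[OF assms(2)]) (rule that)
  define k where "k x = (if x \<in> X then g x else h x)" for x
  have "continuous_on (X \<union> Y) k"
    unfolding k_def using assms(3,4) g(1) h(1,3)
    by (intro continuous_on_cases) (auto simp: f'_def)
  moreover have "k \<in> X \<union> Y \<rightarrow> T - {0}"
    using g(2) h(2) unfolding k_def by (auto simp: Pi_iff)
  moreover have "k x = f x" if "x \<in> A" for x
    using that g(3) h(3)[of x] \<open>A \<subseteq> X \<union> Y\<close> unfolding k_def f'_def by auto
  ultimately show "\<exists>g. continuous_on (X \<union> Y) g \<and> g \<in> X \<union> Y \<rightarrow> T - {0} \<and> (\<forall>x\<in>A. g x = f x)"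
    by (intro exI[of _ k] conjI ballI)
qed

lemma punctured_extension_UN:
  assumes "finite I" "\<And>i. i \<in> I \<Longrightarrow> punctured_extension T (X i)" "\<And>i. i \<in> I \<Longrightarrow> closed (X i)"
  shows "punctured_extension T (\<Union>i\<in>I. X i)"
  using assms
proof (induction I rule: finite_induct)
  case empty
  have "A = {}" if "closedin (top_of_set {}) A" for A :: "'b set"
    using closedin_imp_subset[OF that] by simp
  then show ?case
    unfolding punctured_extension_def by fastforce
next
  case (insert i I)
  have "punctured_extension T (X i \<union> (\<Union>i\<in>I. X i))"
    by (rule punctured_extension_Un) (use insert in auto)
  then show ?case
    by simp
qed

text \<open>
  Here \<open>f\<close> is first pushed out of the half-space of points with negative inner product with \<open>e\<close>:
  on the preimage of that half-space it is replaced by an extension of its restriction to the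
  preimage of the hyperplane orthogonal to \<open>e\<close>.
\<close>

lemma homotopic_const_of_punctured_extension:
  fixes f :: "'a::euclidean_space \<Rightarrow> 'b::euclidean_space"
  assumes T: "subspace T" "e \<in> T" "e \<noteq> 0"
    and Y: "closed Y" "punctured_extension {x \<in> T. e \<bullet> x = 0} Y"
    and f: "continuous_on Y f" "f \<in> Y \<rightarrow> T - {0}"
  shows "homotopic_with_canon (\<lambda>_. True) Y (T - {0}) f (\<lambda>_. e)"
proof -
  have cont: "continuous_on Y (\<lambda>x. e \<bullet> f x)"
    by (intro continuous_intros f)
  define D where "D = {x \<in> Y. e \<bullet> f x \<le> 0}"
  define U where "U = {x \<in> Y. 0 \<le> e \<bullet> f x}"
  define C where "C = {x \<in> Y. e \<bullet> f x = 0}"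
  have closed: "closed D" "closed U" "closed C"
    unfolding D_def U_def C_def
    using continuous_on_closed_Collect_le[OF cont continuous_on_const Y(1), of 0]
      continuous_on_closed_Collect_le[OF continuous_on_const cont Y(1), of 0]
      continuous_closed_preimage_constant[OF cont Y(1), of 0]
    by auto
  have "punctured_extension {x \<in> T. e \<bullet> x = 0} D"
    using Y(2) closed_subset[OF _ closed(1), of Y]
    by (rule punctured_extension_closed_subset) (auto simp: D_def)
  moreover have "closedin (top_of_set D) C"
    using closed by (intro closed_subset) (auto simp: C_def D_def)
  moreover have "continuous_on C f"
    using f(1) by (rule continuous_on_subset) (auto simp: C_def)
  moreover have "f \<in> C \<rightarrow> {x \<in> T. e \<bullet> x = 0} - {0}"
    using f(2) unfolding C_def by auto
  ultimately obtain g where g: "continuous_on D g" "g \<in> D \<rightarrow> {x \<in> T. e \<bullet> x = 0} - {0}"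
      "\<And>x. x \<in> C \<Longrightarrow> g x = f x"
    by (rule punctured_extensionE) (rule that)
  define h where "h x = (if x \<in> D then g x else f x)" for x
  have Y_eq: "Y = D \<union> U"
    unfolding D_def U_def by auto
  have "continuous_on (D \<union> U) h"
    unfolding h_def
  proof (rule continuous_on_cases[OF closed(1,2) g(1)])
    show "continuous_on U f"
      using f(1) by (rule continuous_on_subset) (auto simp: U_def)
    show "\<forall>x. x \<in> D \<and> x \<notin> D \<or> x \<in> U \<and> x \<in> D \<longrightarrow> g x = f x"
      using g(3) unfolding C_def D_def U_def by auto
  qed
  then have h: "continuous_on Y h"
    by (simp add: Y_eq)
  have hT: "h x \<in> T - {0} \<and> 0 \<le> e \<bullet> h x" if "x \<in> Y" for x
  proof (cases "x \<in> D")
    case True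
    then have "g x \<in> {x \<in> T. e \<bullet> x = 0} - {0}"
      using g(2) by blast
    then show ?thesis
      using True unfolding h_def by simp
  next
    case False
    then show ?thesis
      using that f(2) unfolding h_def D_def by auto
  qed
  \<comment> \<open>Where \<open>f\<close> and \<open>h\<close> differ, \<open>f x\<close> lies
    strictly below the hyperplane and \<open>h x\<close> in it, so the segment meets the hyperplane
    only in \<open>h x\<close>, which is nonzero.\<close>
  have "homotopic_with_canon (\<lambda>_. True) Y (T - {0}) f h"
  proof (rule homotopic_with_linear[OF f(1) h])
    fix x assume x: "x \<in> Y"
    show "closed_segment (f x) (h x) \<subseteq> T - {0}"
    proof (cases "x \<in> D \<and> x \<notin> C")
      case False
      then have "h x = f x"
        using g(3) unfolding h_def by auto
      then show ?thesis
        using f(2) x by auto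
    next
      case True
      then have neg: "e \<bullet> f x < 0" and h0: "e \<bullet> h x = 0"
        using g(2) unfolding C_def D_def h_def by auto
      have "(1 - s) *\<^sub>R f x + s *\<^sub>R h x \<in> T - {0}" if "0 \<le> s" "s \<le> 1" for s
      proof
        show "(1 - s) *\<^sub>R f x + s *\<^sub>R h x \<in> T"
          using f(2) hT[OF x] x T(1) by (auto intro!: subspace_add subspace_scale)
        show "(1 - s) *\<^sub>R f x + s *\<^sub>R h x \<notin> {0}"
        proof
          assume 0: "(1 - s) *\<^sub>R f x + s *\<^sub>R h x \<in> {0}"
          then have "e \<bullet> ((1 - s) *\<^sub>R f x + s *\<^sub>R h x) = 0"
            by simp
          then have "s = 1"
            using neg h0 by (simp add: inner_add_right)
          then show False
            using 0 hT[OF x] by simp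
        qed
      qed
      then show ?thesis
        unfolding closed_segment_def by auto
    qed
  qed
  \<comment> \<open>\<open>h\<close> stays in the closed half-space of \<open>e\<close>; by the
    inner product with \<open>e\<close>, the segment from \<open>h x\<close> to \<open>e\<close>
    could vanish only at \<open>h x\<close>, which is nonzero.\<close>
  moreover have "homotopic_with_canon (\<lambda>_. True) Y (T - {0}) h (\<lambda>_. e)"
  proof (rule homotopic_with_linear[OF h])
    fix x assume x: "x \<in> Y"
    have "(1 - s) *\<^sub>R h x + s *\<^sub>R e \<in> T - {0}" if "0 \<le> s" "s \<le> 1" for s
    proof
      show "(1 - s) *\<^sub>R h x + s *\<^sub>R e \<in> T"
        using hT[OF x] x T by (auto intro!: subspace_add subspace_scale)
      show "(1 - s) *\<^sub>R h x + s *\<^sub>R e \<notin> {0}"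
      proof
        assume 0: "(1 - s) *\<^sub>R h x + s *\<^sub>R e \<in> {0}"
        then have "e \<bullet> ((1 - s) *\<^sub>R h x + s *\<^sub>R e) = 0"
          by simp
        then have "(1 - s) * (e \<bullet> h x) + s * (e \<bullet> e) = 0"
          by (simp add: inner_add_right)
        moreover have "0 \<le> (1 - s) * (e \<bullet> h x)" "0 \<le> s * (e \<bullet> e)"
          using that hT[OF x] by simp_all
        ultimately have "s * (e \<bullet> e) = 0"
          by linarith
        then have "s = 0"
          using \<open>e \<noteq> 0\<close> by simp
        then show False
          using 0 hT[OF x] by simp
      qed
    qed
    then show "closed_segment (h x) e \<subseteq> T - {0}"
      unfolding closed_segment_def by auto
  qed simp
  ultimately show ?thesis
    by (rule homotopic_with_trans)
qed

text \<open>Since \<open>X\<close> is closed, closures in it agree with closures in the whole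
  space.\<close>

lemma frontier_of_openin_closed:
  assumes "closed X" "openin (top_of_set X) U"
  shows "top_of_set X frontier_of U = closure U - U"
proof -
  have "U \<subseteq> X"
    using assms(2) openin_imp_subset by blast
  then have "top_of_set X closure_of U = closure U"
    using assms(1) by (simp add: closure_of_subtopology Int_absorb1 closure_minimal)
  then show ?thesis
    using assms(2) by (simp add: frontier_of_def interior_of_openin)
qed

text \<open>Induction on \<open>d\<close>. Extend \<open>f\<close> to \<open>F\<close> with values
  in \<open>T\<close>, where zeros may appear away from \<open>A\<close>. Cover the zeros by
  finitely many relatively open sets whose frontiers have smaller dimension. On the frontier of
  their union \<open>V\<close> the map \<open>F\<close> is null-homotopic in \<open>T - {0}\<close>,
  hence it can be redefined on \<open>closure V\<close> without zeros.\<close>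

lemma punctured_extension_of_dim_le:
  fixes X :: "'a::euclidean_space set" and T :: "'b::euclidean_space set"
  assumes "compact X" "top_of_set X dim_le int d - 1" "subspace T" "dim T = d"
  shows "punctured_extension T X"
  using assms
proof (induction d arbitrary: X T)
  case 0
  then have "topspace (top_of_set X) = {}"
    by simp
  then have "X = {}"
    by simp
  then show ?case
    by (simp add: punctured_extension_def)
next
  case (Suc d)
  have "closed X"
    using Suc.prems(1) by (rule compact_imp_closed)
  obtain e where e: "e \<in> T" "e \<noteq> 0"
    using Suc.prems(3,4) dim_eq_0[of T] by (metis nat.distinct(1) singletonI subsetI)
  \<comment> \<open>The orthogonal complement of \<open>e\<close> in \<open>T\<close> is the
    \<open>d\<close>-dimensional target for which the induction hypothesis is applied to the
    frontiers.\<close>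
  define T0 where "T0 = {x \<in> T. e \<bullet> x = 0}"
  have T0: "subspace T0"
    unfolding T0_def using subspace_inter[OF Suc.prems(3) subspace_hyperplane[of e]]
    by (simp add: Int_def)
  have dimT0: "dim T0 = d"
  proof -
    have "span {e} \<subseteq> T"
      using e(1) Suc.prems(3) by (intro span_minimal) auto
    then have "dim {y \<in> T. \<forall>x\<in>span {e}. orthogonal x y} + dim (span {e}) = dim T"
      by (intro dim_subspace_orthogonal_to_vectors subspace_span Suc.prems(3))
    moreover have "(\<forall>x\<in>span {e}. orthogonal x y) \<longleftrightarrow> e \<bullet> y = 0" for y
      by (auto simp: span_singleton orthogonal_def)
    moreover have "dim (span {e}) = 1"
      using e(2) by simp
    ultimately show ?thesis
      using Suc.prems(4) unfolding T0_def by simp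
  qed
  show ?case
    unfolding punctured_extension_def
  proof (intro allI impI)
    fix A f assume A: "closedin (top_of_set X) A" and f: "continuous_on A f" "f \<in> A \<rightarrow> T - {0}"
    have "closed A"
      using A \<open>closed X\<close> closedin_closed_trans by blast
    obtain F where F: "continuous_on X F" "F ` X \<subseteq> T" "\<And>x. x \<in> A \<Longrightarrow> F x = f x"
      using Dugundji[OF subspace_imp_convex[OF Suc.prems(3)] _ A f(1)] e f(2) by blast
    define Z where "Z = {x \<in> X. F x = 0}"
    have "compact Z"
      unfolding Z_def using F(1) \<open>closed X\<close> \<open>compact X\<close>
      by (metis (mono_tags) continuous_closed_preimage_constant compact_Int_closed Collect_conj_eq
          Collect_mem_eq Int_absorb Int_assoc)
    have "\<exists>U. z \<in> U \<and> openin (top_of_set X) U \<and> closure U \<inter> A = {} \<and>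
        top_of_set (closure U - U) dim_le int d - 1" if z: "z \<in> Z" for z
    proof -
      have "z \<notin> A"
        using z F(3) f(2) unfolding Z_def by force
      then obtain r where r: "0 < r" "cball z r \<subseteq> - A"
        using \<open>closed A\<close> by (meson ComplI open_Compl open_contains_cball)
      have "openin (top_of_set X) (X \<inter> ball z r)" "z \<in> X \<inter> ball z r"
        using r z unfolding Z_def by auto
      then obtain U where U: "z \<in> U" "U \<subseteq> X \<inter> ball z r" "openin (top_of_set X) U"
          "subtopology (top_of_set X) (top_of_set X frontier_of U) dim_le int (Suc d) - 1 - 1"
        using iffD1[OF dimension_le.simps Suc.prems(2)] by metis
      have "closure U \<subseteq> cball z r"
        using U(2) by (intro closure_minimal) auto
      moreover have "top_of_set (closure U - U) dim_le int d - 1"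
        using U(4) frontier_of_openin_closed[OF \<open>closed X\<close> U(3)]
          frontier_of_subset_topspace[of "top_of_set X" U]
        by (simp add: subtopology_subtopology Int_absorb1)
      ultimately show ?thesis
        using U(1,3) r(2) by blast
    qed
    then obtain U where U: "\<And>z. z \<in> Z \<Longrightarrow> z \<in> U z" "\<And>z. z \<in> Z \<Longrightarrow> openin (top_of_set X) (U z)"
      "\<And>z. z \<in> Z \<Longrightarrow> closure (U z) \<inter> A = {}"
      "\<And>z. z \<in> Z \<Longrightarrow> top_of_set (closure (U z) - U z) dim_le int d - 1"
      by metis
    obtain I where I: "I \<subseteq> Z" "finite I" "Z \<subseteq> (\<Union>z\<in>I. U z)"
    proof -
      have "\<forall>z\<in>Z. \<exists>W. open W \<and> U z = X \<inter> W"
        using U(2) by (auto simp: openin_open)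
      then obtain W where W: "\<And>z. z \<in> Z \<Longrightarrow> open (W z) \<and> U z = X \<inter> W z"
        by metis
      have "Z \<subseteq> (\<Union>z\<in>Z. W z)"
        using W U(1) by blast
      then obtain I where "I \<subseteq> Z" "finite I" "Z \<subseteq> (\<Union>z\<in>I. W z)"
        using compactE_image[OF \<open>compact Z\<close>, of Z W] W by blast
      then show ?thesis
        using W that[of I] unfolding Z_def by blast
    qed
    define V where "V = (\<Union>z\<in>I. U z)"
    have V: "openin (top_of_set X) V"
      unfolding V_def using U(2) I(1) by blast
    have "V \<subseteq> X"
      using V openin_imp_subset by blast
    then have "closure V \<subseteq> X"
      using \<open>closed X\<close> by (simp add: closure_minimal)
    have clV: "closure V = (\<Union>z\<in>I. closure (U z))"
      unfolding V_def using I(2) by (induction I rule: finite_induct) auto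
    have "closed (X - V)"
      using V \<open>closed X\<close> by (metis closedin_closed_trans closedin_diff closedin_topspace
          topspace_euclidean_subtopology)
    \<comment> \<open>The frontier of the finite union is a closed subset of the union of the
      frontiers, and each of these falls under the induction hypothesis.\<close>
    have "punctured_extension T0 (\<Union>z\<in>I. closure (U z) - U z)"
    proof (rule punctured_extension_UN[OF I(2)])
      fix z assume z: "z \<in> I"
      have "closedin (top_of_set X) (closure (U z) - U z)"
        using frontier_of_openin_closed[OF \<open>closed X\<close> U(2)] z I(1)
          closedin_frontier_of[of "top_of_set X" "U z"] by auto
      then show clo: "closed (closure (U z) - U z)"
        using \<open>closed X\<close> closedin_closed_trans by blast
      have "compact (closure (U z) - U z)"
        using \<open>compact X\<close> clo \<open>closedin (top_of_set X) (closure (U z) - U z)\<close>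
        by (meson closedin_compact)
      then show "punctured_extension T0 (closure (U z) - U z)"
        using U(4) z I(1) by (intro Suc.IH T0 dimT0) auto
    qed
    moreover have clo: "closed (closure V - V)"
      using \<open>closed (X - V)\<close> \<open>closure V \<subseteq> X\<close>
      by (metis Diff_Int2 Int_Diff closed_Int closed_closure inf.absorb1)
    moreover have "closure V - V \<subseteq> (\<Union>z\<in>I. closure (U z) - U z)"
      unfolding clV by (auto simp: V_def)
    ultimately have "punctured_extension T0 (closure V - V)"
      by (meson closed_subset punctured_extension_closed_subset)
    moreover have "continuous_on (closure V - V) F"
      using F(1) by (rule continuous_on_subset) (use \<open>closure V \<subseteq> X\<close> in auto)
    moreover have FV: "F \<in> (X - V) \<rightarrow> T - {0}"
      using F(2) I(3) unfolding V_def Z_def by auto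
    ultimately have "homotopic_with_canon (\<lambda>_. True) (closure V - V) (T - {0}) F (\<lambda>_. e)"
      using \<open>closure V \<subseteq> X\<close> unfolding T0_def
      by (intro homotopic_const_of_punctured_extension Suc.prems e clo) auto
    then have hom: "homotopic_with_canon (\<lambda>_. True) (closure V - V) (T - {0}) (\<lambda>_. e) F"
      by (rule homotopic_with_symD)
    \<comment> \<open>The constant map extends over \<open>closure V\<close>, and
      \<open>T - {0}\<close> is an ANR, being relatively open in a convex set; by Borsuk's theorem
      the homotopic map \<open>F\<close> extends from the frontier as well.\<close>
    have ANR: "ANR (T - {0})"
      using convex_imp_ANR[OF subspace_imp_convex[OF Suc.prems(3)]]
      by (rule ANR_openin) (simp add: openin_delete)
    have clo': "closedin (top_of_set (closure V)) (closure V - V)"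
      using clo by (intro closed_subset) auto
    have "(\<lambda>_. e) \<in> closure V \<rightarrow> T - {0}"
      using e by simp
    then obtain g where g: "continuous_on (closure V) g" "g ` closure V \<subseteq> T - {0}"
        "\<And>x. x \<in> closure V - V \<Longrightarrow> g x = F x"
      using Borsuk_homotopy_extension_homotopic[OF clo' disjI2[OF ANR] continuous_on_const _ hom]
      by metis
    define h where "h x = (if x \<in> closure V then g x else F x)" for x
    have X_eq: "X = closure V \<union> (X - V)"
      using \<open>closure V \<subseteq> X\<close> closure_subset by auto
    have "continuous_on (closure V \<union> (X - V)) h"
      unfolding h_def
    proof (rule continuous_on_cases[OF closed_closure \<open>closed (X - V)\<close> g(1)])
      show "continuous_on (X - V) F"
        using F(1) by (rule continuous_on_subset) auto
    qed (use g(3) in auto)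
    then have "continuous_on X h"
      using X_eq by simp
    moreover have "h \<in> X \<rightarrow> T - {0}"
    proof
      fix x assume "x \<in> X"
      show "h x \<in> T - {0}"
      proof (cases "x \<in> closure V")
        case True
        then show ?thesis
          using g(2) unfolding h_def by auto
      next
        case False
        then have "x \<in> X - V"
          using \<open>x \<in> X\<close> closure_subset by blast
        then show ?thesis
          using FV False unfolding h_def by (auto simp: Pi_iff)
      qed
    qed
    moreover have "h x = f x" if "x \<in> A" for x
    proof -
      have "x \<notin> closure V"
        using that U(3) I(1) unfolding clV by auto
      then show ?thesis
        using F(3) that unfolding h_def by simp
    qed
    ultimately show "\<exists>g. continuous_on X g \<and> g \<in> X \<rightarrow> T - {0} \<and> (\<forall>x\<in>A. g x = f x)"
      by blast
  qed
qed

text \<open>An extension \<open>g\<close> of \<open>x - a\<close> from the relative sphere yields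
  the continuous self-map \<open>h\<close> of the ball, which sends \<open>x\<close> to the point of
  the sphere opposite to the direction \<open>g x\<close>. A Brouwer fixed point would lie on the
  sphere, where \<open>h\<close> is the antipodal map.\<close>

lemma not_punctured_extension_cball:
  fixes T :: "'a::euclidean_space set"
  assumes "subspace T" "a \<in> T" "0 < r"
  shows "\<not> punctured_extension T (T \<inter> cball a r)"
proof
  let ?X = "T \<inter> cball a r"
  assume ext: "punctured_extension T ?X"
  have "closed T"
    using assms(1) by (rule closed_subspace)
  then have "closedin (top_of_set ?X) (T \<inter> sphere a r)"
    by (intro closed_subset closed_Int) auto
  moreover have "continuous_on (T \<inter> sphere a r) (\<lambda>x. x - a)"
    by (intro continuous_intros)
  moreover have "(\<lambda>x. x - a) \<in> T \<inter> sphere a r \<rightarrow> T - {0}"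
    using assms by (auto intro: subspace_diff)
  ultimately obtain g where g: "continuous_on ?X g" "g \<in> ?X \<rightarrow> T - {0}"
      "\<And>x. x \<in> T \<inter> sphere a r \<Longrightarrow> g x = x - a"
    using punctured_extensionE[OF ext] by metis
  define h where "h x = a - (r / norm (g x)) *\<^sub>R g x" for x
  have g0: "norm (g x) \<noteq> 0" if "x \<in> ?X" for x
    using g(2) that by auto
  have "continuous_on ?X h"
    unfolding h_def using g0 by (intro continuous_intros g(1)) auto
  moreover have h: "h x \<in> T \<inter> sphere a r" if "x \<in> ?X" for x
  proof
    show "h x \<in> T"
      unfolding h_def using g(2) that assms by (intro subspace_diff subspace_scale) auto
    show "h x \<in> sphere a r"
      unfolding h_def using g0[OF that] assms(3) by (simp add: dist_norm)
  qed
  moreover have "compact ?X" "convex ?X" "?X \<noteq> {}"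
    using assms \<open>closed T\<close> by (auto intro: closed_Int_compact convex_Int subspace_imp_convex)
  ultimately obtain x where x: "x \<in> ?X" "h x = x"
    using brouwer[of ?X h] sphere_cball[of a r] by blast
  then have "x \<in> T \<inter> sphere a r"
    using h by metis
  then have "g x = x - a" "norm (x - a) = r"
    using g(3) by (auto simp: dist_norm norm_minus_commute)
  then have "a - (x - a) = x"
    using x(2) assms(3) unfolding h_def by simp
  then have "2 *\<^sub>R (x - a) = 0"
    by (simp add: algebra_simps scaleR_2)
  then show False
    using \<open>norm (x - a) = r\<close> assms(3) by simp
qed

lemma not_dim_le_cball:
  fixes T :: "'a::euclidean_space set"
  assumes "subspace T" "a \<in> T" "0 < r" "n < int (dim T)"
  shows "\<not> top_of_set (T \<inter> cball a r) dim_le n"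
proof
  assume "top_of_set (T \<inter> cball a r) dim_le n"
  then have "top_of_set (T \<inter> cball a r) dim_le int (dim T) - 1"
    by (rule dimension_le_mono) (use assms(4) in simp)
  moreover have "compact (T \<inter> cball a r)"
    using closed_subspace[OF assms(1)] by (intro closed_Int_compact) auto
  ultimately have "punctured_extension T (T \<inter> cball a r)"
    using assms(1) by (intro punctured_extension_of_dim_le) auto
  then show False
    using not_punctured_extension_cball[OF assms(1-3)] by contradiction
qed

section \<open>Tropical spans\<close>

lemma eq_MAX_iff:
  fixes f :: "'i \<Rightarrow> 'b::linorder"
  assumes "finite K" "K \<noteq> {}"
  shows "x = (MAX l\<in>K. f l) \<longleftrightarrow> (\<forall>l\<in>K. f l \<le> x) \<and> (\<exists>l\<in>K. f l = x)"
proof -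
  have "x = (MAX l\<in>K. f l) \<longleftrightarrow> (MAX l\<in>K. f l) = x"
    by auto
  also have "\<dots> \<longleftrightarrow> (\<forall>l\<in>K. f l \<le> x) \<and> (\<exists>l\<in>K. f l = x)"
    using assms by (subst Max_eq_iff) auto
  finally show ?thesis .
qed

lemma MAX_attained:
  fixes f :: "'i \<Rightarrow> 'b::linorder"
  assumes "finite K" "K \<noteq> {}"
  shows "\<exists>l\<in>K. f l = (MAX l\<in>K. f l)"
  using eq_MAX_iff[OF assms, of "MAX l\<in>K. f l" f] by blast

lemma trop_span_subset:
  assumes "G \<subseteq> trop_span H"
  shows "trop_span G \<subseteq> trop_span H"
proof
  fix x assume "x \<in> trop_span G"
  then show "x \<in> trop_span H"
    by induction (use assms in \<open>auto intro: trop_span.intros\<close>)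
qed

text \<open>The tropical product of the matrix with columns \<open>g l\<close> and the vector
  \<open>y\<close>. All coefficients are finite, so no generator can be left out of the
  maximum.\<close>

definition trop_comb :: "'i set \<Rightarrow> ('i \<Rightarrow> real^'n) \<Rightarrow> ('i \<Rightarrow> real) \<Rightarrow> real^'n" where
  "trop_comb K g y = (\<chi> i. MAX l\<in>K. y l + g l $ i)"

lemma eq_trop_comb_iff:
  assumes "finite K" "K \<noteq> {}"
  shows "x = trop_comb K g y \<longleftrightarrow>
    (\<forall>i. (\<forall>l\<in>K. y l + g l $ i \<le> x $ i) \<and> (\<exists>l\<in>K. y l + g l $ i = x $ i))"
  unfolding trop_comb_def vec_eq_iff vec_lambda_beta eq_MAX_iff[OF assms] by (rule refl)

lemma trop_comb_ge:
  assumes "finite K" "l \<in> K"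
  shows "y l + g l $ i \<le> trop_comb K g y $ i"
  using eq_trop_comb_iff[of K "trop_comb K g y" g y] assms by auto

lemma trop_comb_attained:
  assumes "finite K" "K \<noteq> {}"
  shows "\<exists>l\<in>K. y l + g l $ i = trop_comb K g y $ i"
  using eq_trop_comb_iff[OF assms, of "trop_comb K g y" g y] by simp

lemma trop_comb_in_span:
  assumes "finite K" "K \<noteq> {}"
  shows "trop_comb K g y \<in> trop_span (g ` K)"
  using assms
proof (induction K rule: finite_ne_induct)
  case (singleton k)
  have "trop_comb {k} g y = (\<chi> i. y k + g k $ i)"
    unfolding trop_comb_def by simp
  then show ?case
    by (simp add: trop_span.gen trop_span.scale)
next
  case (insert k K)
  have "trop_comb (insert k K) g y
      = (\<chi> i. max ((\<chi> i. y k + g k $ i) $ i) (trop_comb K g y $ i))"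
    unfolding trop_comb_def using insert.hyps by simp
  moreover have "(\<chi> i. y k + g k $ i) \<in> trop_span (g ` insert k K)"
    by (intro trop_span.scale trop_span.gen) simp
  moreover have "trop_comb K g y \<in> trop_span (g ` insert k K)"
    using insert.IH trop_span_subset[of "g ` K" "g ` insert k K"] by (auto intro: trop_span.gen)
  ultimately show ?case
    by (simp only: trop_span.add)
qed

lemma trop_span_image:
  fixes g :: "'i \<Rightarrow> real^'n"
  assumes "finite K" "K \<noteq> {}"
  shows "trop_span (g ` K) = range (trop_comb K g)"
proof
  show "range (trop_comb K g) \<subseteq> trop_span (g ` K)"
    using trop_comb_in_span[OF assms] by blast
  show "trop_span (g ` K) \<subseteq> range (trop_comb K g)"
  proof
    fix x assume "x \<in> trop_span (g ` K)"
    then have "\<exists>y. x = trop_comb K g y"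
    proof induction
      case (gen x)
      then obtain k where k: "k \<in> K" "x = g k"
        by blast
      \<comment> \<open>The largest coefficient that keeps the multiple of \<open>g l\<close> below
        \<open>g k\<close>; for \<open>l = k\<close> it is 0, so the maximum is
        \<open>g k\<close>.\<close>
      define y where "y l = (MIN i. g k $ i - g l $ i)" for l
      have "y l + g l $ i \<le> x $ i" for l i
      proof -
        have "y l \<le> g k $ i - g l $ i"
          unfolding y_def by (intro Min_le) auto
        then show ?thesis
          using k by simp
      qed
      moreover have "y k = 0"
        unfolding y_def by (simp add: image_constant_conv)
      ultimately have "x = trop_comb K g y"
        using k by (subst eq_trop_comb_iff[OF assms]) force
      then show ?case
        by blast
    next
      case (add x x')
      then obtain y y' where "x = trop_comb K g y" "x' = trop_comb K g y'"
        by blast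
      then have y: "\<And>i l. l \<in> K \<Longrightarrow> y l + g l $ i \<le> x $ i" "\<And>i. \<exists>l\<in>K. y l + g l $ i = x $ i"
        and y': "\<And>i l. l \<in> K \<Longrightarrow> y' l + g l $ i \<le> x' $ i"
          "\<And>i. \<exists>l\<in>K. y' l + g l $ i = x' $ i"
        using eq_trop_comb_iff[OF assms] by blast+
      have "(\<chi> i. max (x $ i) (x' $ i)) = trop_comb K g (\<lambda>l. max (y l) (y' l))"
      proof (subst eq_trop_comb_iff[OF assms], intro allI conjI ballI)
        fix i l assume l: "l \<in> K"
        show "max (y l) (y' l) + g l $ i \<le> (\<chi> i. max (x $ i) (x' $ i)) $ i"
          using y(1)[OF l, of i] y'(1)[OF l, of i] by (auto simp: max_def)
      next
        fix i
        obtain l l' where l: "l \<in> K" "y l + g l $ i = x $ i" and l': "l' \<in> K" "y' l' + g l' $ i = x' $ i"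
          using y(2) y'(2) by blast
        show "\<exists>l\<in>K. max (y l) (y' l) + g l $ i = (\<chi> i. max (x $ i) (x' $ i)) $ i"
        proof (cases "x $ i \<ge> x' $ i")
          case True
          then have "max (y l) (y' l) + g l $ i = (\<chi> i. max (x $ i) (x' $ i)) $ i"
            using l y'(1)[OF l(1), of i] by (auto simp: max_def)
          then show ?thesis
            using l(1) by blast
        next
          case False
          then have "max (y l') (y' l') + g l' $ i = (\<chi> i. max (x $ i) (x' $ i)) $ i"
            using l' y(1)[OF l'(1), of i] by (auto simp: max_def)
          then show ?thesis
            using l'(1) by blast
        qed
      qed
      then show ?case
        by blast
    next
      case (scale x c)
      then obtain y where "x = trop_comb K g y"
        by blast
      then have y: "\<And>i. (\<forall>l\<in>K. y l + g l $ i \<le> x $ i) \<and> (\<exists>l\<in>K. y l + g l $ i = x $ i)"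
        using eq_trop_comb_iff[OF assms] by blast
      have "(\<chi> i. c + x $ i) = trop_comb K g (\<lambda>l. c + y l)"
        using y by (subst eq_trop_comb_iff[OF assms]) (simp add: add.assoc)
      then show ?case
        by blast
    qed
    then show "x \<in> range (trop_comb K g)"
      by blast
  qed
qed

lemma finite_columns: "finite (columns (N :: real^'n^'m))"
proof -
  have "columns N = range (\<lambda>i. column i N)"
    unfolding columns_def by auto
  then show ?thesis
    by simp
qed

lemma card_columns_le: "card (columns (N :: real^'n^'m)) \<le> CARD('n)"
proof -
  have "columns N = range (\<lambda>i. column i N)"
    unfolding columns_def by auto
  then show ?thesis
    by (simp add: card_image_le)
qed

text \<open>A generating set of least size is indexed by a subset of the column index type, which is
  large enough because the columns generate. Omitting a redundant member would contradict
  minimality.\<close>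

lemma irredundant_generators:
  fixes N :: "real^'n^'n"
  obtains K :: "'n set" and g where "K \<noteq> {}" "card K = column_generator_rank N"
    "trop_span (g ` K) = column_space N" "\<And>j. j \<in> K \<Longrightarrow> g j \<notin> trop_span (g ` (K - {j}))"
proof -
  let ?P = "\<lambda>k. \<exists>G. finite G \<and> card G = k \<and> trop_span G = column_space N"
  have P: "?P (card (columns N))"
    using finite_columns unfolding column_space_def by blast
  have k: "column_generator_rank N = (LEAST k. ?P k)"
    unfolding column_generator_rank_def generator_dimension_def by (rule refl)
  obtain G where G: "finite G" "card G = column_generator_rank N" "trop_span G = column_space N"
    using LeastI[of ?P, OF P] unfolding k by blast
  have "column_generator_rank N \<le> CARD('n)"
    using Least_le[of ?P, OF P] card_columns_le[of N] unfolding k by simp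
  then obtain K :: "'n set" where K: "card K = card G"
    using obtain_subset_with_card_n[of "card G" "UNIV :: 'n set"] G(2) by metis
  then obtain g where g: "bij_betw g K G"
    using finite_same_card_bij[of K G] G(1) by auto
  then have gK: "g ` K = G" "inj_on g K"
    by (auto simp: bij_betw_def)
  show ?thesis
  proof
    show "card K = column_generator_rank N" "trop_span (g ` K) = column_space N"
      using K G gK by simp_all
    \<comment> \<open>The empty set spans nothing, while the column space contains the
      columns.\<close>
    show "K \<noteq> {}"
    proof
      assume "K = {}"
      then have "trop_span {} = column_space N"
        using gK G(3) by simp
      moreover have "column undefined N \<in> column_space N"
        unfolding column_space_def by (rule trop_span.gen) (auto simp: columns_def)
      moreover have "x \<notin> trop_span {}" for x :: "real^'n"
      proof
        assume "x \<in> trop_span {}"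
        then show False
          by induction auto
      qed
      ultimately show False
        by blast
    qed
    fix j assume j: "j \<in> K"
    show "g j \<notin> trop_span (g ` (K - {j}))"
    proof
      assume gj: "g j \<in> trop_span (g ` (K - {j}))"
      then have "g ` K \<subseteq> trop_span (g ` (K - {j}))"
        by (auto intro: trop_span.gen)
      then have "trop_span (g ` K) \<subseteq> trop_span (g ` (K - {j}))"
        by (rule trop_span_subset)
      moreover have "trop_span (g ` (K - {j})) \<subseteq> trop_span (g ` K)"
        by (rule trop_span_subset) (auto intro: trop_span.gen)
      ultimately have "trop_span (g ` (K - {j})) = column_space N"
        using gK G(3) by auto
      then have "column_generator_rank N \<le> card (g ` (K - {j}))"
        unfolding k by (intro Least_le exI[of _ "g ` (K - {j})"]) auto
      also have "\<dots> \<le> card (K - {j})"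
        by (rule card_image_le) simp
      also have "\<dots> < card K"
        using j by (intro card_Diff1_less) auto
      finally show False
        using K G(2) by simp
    qed
  qed
qed

text \<open>
  After adding \<open>- a i\<close> to the rows and \<open>- b j\<close> to the columns, a dominant minor has zeros on its
  diagonal and negative entries elsewhere.
\<close>

definition dominant_minor ::
    "real^'n^'n \<Rightarrow> 'i set \<Rightarrow> ('i \<Rightarrow> 'n) \<Rightarrow> ('i \<Rightarrow> 'n) \<Rightarrow> ('i \<Rightarrow> real) \<Rightarrow> ('i \<Rightarrow> real) \<Rightarrow> bool" where
  "dominant_minor M K r c a b \<longleftrightarrow>
    (\<forall>i\<in>K. M $ r i $ c i = a i + b i) \<and> (\<forall>i\<in>K. \<forall>j\<in>K. i \<noteq> j \<longrightarrow> M $ r i $ c j < a i + b j)"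

text \<open>The predicate minimized in \<open>factor_rank\<close>.\<close>

definition factors_through :: "nat \<Rightarrow> real^'n^'n \<Rightarrow> bool" where
  "factors_through k M \<longleftrightarrow> k > 0 \<and>
     (\<exists>(B :: 'n \<Rightarrow> nat \<Rightarrow> real) (C :: nat \<Rightarrow> 'n \<Rightarrow> real).
        \<forall>i j. M $ i $ j = (MAX l\<in>{..<k}. B i l + C l j))"

text \<open>\<open>N B\<close> fixes each column of \<open>N\<close> by regularity and is tropically
  linear, so it fixes the column space. The equation \<open>N B x = x\<close> is split into bound
  and attainment to avoid nested maxima.\<close>

lemma regular_column_space:
  fixes N B :: "real^'n^'n"
  assumes "N \<otimes>\<^sub>T B \<otimes>\<^sub>T N = N" "x \<in> column_space N"
  shows "\<And>i c s. N $ i $ c + B $ c $ s + x $ s \<le> x $ i"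
    and "\<And>i. \<exists>c s. N $ i $ c + B $ c $ s + x $ s = x $ i"
proof -
  have fin: "finite (UNIV :: 'n set)" "(UNIV :: 'n set) \<noteq> {}"
    by auto
  have entry: "N $ i $ j = (MAX s. (MAX c. N $ i $ c + B $ c $ s) + N $ s $ j)" for i j
    using arg_cong[OF assms(1), of "\<lambda>A. A $ i $ j"] unfolding trop_mult_def by simp
  have "(\<forall>i c s. N $ i $ c + B $ c $ s + x $ s \<le> x $ i)
      \<and> (\<forall>i. \<exists>c s. N $ i $ c + B $ c $ s + x $ s = x $ i)"
    using assms(2) unfolding column_space_def
  proof induction
    case (gen x)
    then obtain j where x: "\<And>i. x $ i = N $ i $ j"
      unfolding columns_def column_def by auto
    have "N $ i $ c + B $ c $ s + N $ s $ j \<le> N $ i $ j" for i c s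
    proof -
      have "N $ i $ c + B $ c $ s \<le> (MAX c. N $ i $ c + B $ c $ s)"
        by (rule Max_ge) auto
      moreover have "(MAX c. N $ i $ c + B $ c $ s) + N $ s $ j \<le> N $ i $ j"
        using entry[of i j] unfolding eq_MAX_iff[OF fin] by blast
      ultimately show ?thesis
        by linarith
    qed
    moreover have "\<exists>c s. N $ i $ c + B $ c $ s + N $ s $ j = N $ i $ j" for i
    proof -
      obtain s where "(MAX c. N $ i $ c + B $ c $ s) + N $ s $ j = N $ i $ j"
        using entry[of i j] unfolding eq_MAX_iff[OF fin] by blast
      moreover obtain c where "N $ i $ c + B $ c $ s = (MAX c. N $ i $ c + B $ c $ s)"
        using MAX_attained[OF fin, of "\<lambda>c. N $ i $ c + B $ c $ s"] by blast
      ultimately show ?thesis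
        by metis
    qed
    ultimately show ?case
      by (simp add: x)
  next
    case (add x y)
    show ?case
    proof (intro conjI allI)
      fix i c s
      have "N $ i $ c + B $ c $ s + x $ s \<le> x $ i" "N $ i $ c + B $ c $ s + y $ s \<le> y $ i"
        using add.IH by blast+
      then show "N $ i $ c + B $ c $ s + (\<chi> i. max (x $ i) (y $ i)) $ s
          \<le> (\<chi> i. max (x $ i) (y $ i)) $ i"
        by (auto simp: max_def)
    next
      fix i
      obtain c s c' s' where "N $ i $ c + B $ c $ s + x $ s = x $ i"
        "N $ i $ c' + B $ c' $ s' + y $ s' = y $ i"
        using add.IH by blast
      moreover have "N $ i $ c + B $ c $ s + y $ s \<le> y $ i" "N $ i $ c' + B $ c' $ s' + x $ s' \<le> x $ i"
        using add.IH by blast+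
      ultimately have "N $ i $ c + B $ c $ s + max (x $ s) (y $ s) = max (x $ i) (y $ i)
          \<or> N $ i $ c' + B $ c' $ s' + max (x $ s') (y $ s') = max (x $ i) (y $ i)"
        by (auto simp: max_def)
      then show "\<exists>c s. N $ i $ c + B $ c $ s + (\<chi> i. max (x $ i) (y $ i)) $ s
          = (\<chi> i. max (x $ i) (y $ i)) $ i"
        by auto
    qed
  next
    case (scale x c)
    then show ?case
      by (simp add: add.left_commute[of _ c] add.assoc)
  qed
  then show "\<And>i c s. N $ i $ c + B $ c $ s + x $ s \<le> x $ i"
    and "\<And>i. \<exists>c s. N $ i $ c + B $ c $ s + x $ s = x $ i"
    by blast+
qed

section \<open>Generators of the column space of a regular matrix\<close>

locale regular_generators =
  fixes N B :: "real^'n^'n" and K :: "'n set" and g :: "'n \<Rightarrow> real^'n"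
  assumes regular: "N \<otimes>\<^sub>T B \<otimes>\<^sub>T N = N"
    and K_nonempty: "K \<noteq> {}"
    and span: "trop_span (g ` K) = column_space N"
    and irredundant: "\<And>j. j \<in> K \<Longrightarrow> g j \<notin> trop_span (g ` (K - {j}))"
begin

lemma column_space_eq: "column_space N = range (trop_comb K g)"
  using trop_span_image[of K g] K_nonempty span by simp

definition R :: "'n \<Rightarrow> 'n \<Rightarrow> real" where
  "R l j = (SOME y. column j N = trop_comb K g y) l"

lemma R: "N $ i $ j = (MAX l\<in>K. g l $ i + R l j)"
proof -
  have "column j N \<in> column_space N"
    unfolding column_space_def by (rule trop_span.gen) (auto simp: columns_def)
  then have "\<exists>y. column j N = trop_comb K g y"
    unfolding column_space_eq by blast
  then have "column j N = trop_comb K g (\<lambda>l. R l j)"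
    unfolding R_def by (rule someI_ex)
  then have "column j N $ i = trop_comb K g (\<lambda>l. R l j) $ i"
    by simp
  then show ?thesis
    unfolding trop_comb_def column_def by (simp add: add.commute)
qed

lemma R_le: "l \<in> K \<Longrightarrow> g l $ i + R l j \<le> N $ i $ j"
  and R_attained: "\<exists>l\<in>K. g l $ i + R l j = N $ i $ j"
  using R[of i j] unfolding eq_MAX_iff[OF finite K_nonempty] by blast+

text \<open>
  If \<open>G\<close> is the matrix with columns \<open>g l\<close>, then \<open>N = G R\<close> and \<open>D x = R B x\<close>, so \<open>G (D x) = N B x\<close>, which
  is \<open>x\<close> for every \<open>x\<close> in the column space.
\<close>

definition D :: "real^'n \<Rightarrow> 'n \<Rightarrow> real" where
  "D x l = (MAX p. R l (fst p) + B $ fst p $ snd p + x $ snd p)"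

lemma D_ge: "R l c + B $ c $ s + x $ s \<le> D x l"
  unfolding D_def by (rule Max_ge) (auto intro!: image_eqI[of _ _ "(c, s)"])

lemma D_attained: "\<exists>c s. R l c + B $ c $ s + x $ s = D x l"
  using MAX_attained[of UNIV "\<lambda>p. R l (fst p) + B $ fst p $ snd p + x $ snd p"]
  unfolding D_def by auto

lemma trop_comb_D:
  assumes "x \<in> column_space N"
  shows "trop_comb K g (D x) = x"
proof (rule sym, subst eq_trop_comb_iff, goal_cases)
  case 3
  show ?case
  proof (intro allI conjI ballI)
    fix i l assume l: "l \<in> K"
    obtain c s where "R l c + B $ c $ s + x $ s = D x l"
      using D_attained by blast
    then show "D x l + g l $ i \<le> x $ i"
      using R_le[OF l, of i c] regular_column_space(1)[OF regular assms, of i c s] by linarith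
  next
    fix i
    \<comment> \<open>The generator attaining \<open>N $ i $ c\<close>, for a pair \<open>c\<close>,
      \<open>s\<close> that attains \<open>x $ i\<close>, also attains \<open>x $ i\<close>.\<close>
    obtain c s where cs: "N $ i $ c + B $ c $ s + x $ s = x $ i"
      using regular_column_space(2)[OF regular assms] by blast
    obtain l where l: "l \<in> K" "g l $ i + R l c = N $ i $ c"
      using R_attained by blast
    obtain c' s' where cs': "R l c' + B $ c' $ s' + x $ s' = D x l"
      using D_attained by blast
    have "D x l + g l $ i \<le> x $ i"
      using cs' R_le[OF l(1), of i c'] regular_column_space(1)[OF regular assms, of i c' s']
      by linarith
    then have "D x l + g l $ i = x $ i"
      using cs l(2) D_ge[of l c s x] by linarith
    then show "\<exists>l\<in>K. D x l + g l $ i = x $ i"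
      using l(1) by blast
  qed
qed (use K_nonempty in auto)

lemma gen_in_column_space: "j \<in> K \<Longrightarrow> g j \<in> column_space N"
  using span by (auto intro: trop_span.gen)

text \<open>\<open>D (g j) i\<close> is the entry \<open>P i j\<close> of \<open>P = R B G\<close>,
  and this is the inequality half of \<open>G P = G\<close>.\<close>

lemma D_gen_le: "i \<in> K \<Longrightarrow> j \<in> K \<Longrightarrow> D (g j) i + g i $ s \<le> g j $ s"
  using trop_comb_ge[of K i "D (g j)" g s] trop_comb_D[OF gen_in_column_space] by simp

text \<open>The value is at most 0 by \<open>D_gen_le\<close>. If it were negative, the term of
  \<open>g j\<close> would never attain the maximum in \<open>trop_comb K g (D (g j))\<close>, so
  the other generators would produce \<open>g j\<close>.\<close>

lemma D_gen_self:
  assumes "j \<in> K"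
  shows "D (g j) j = 0"
proof (rule ccontr)
  assume "D (g j) j \<noteq> 0"
  then have neg: "D (g j) j < 0"
    using D_gen_le[OF assms assms, of undefined] by simp
  have attained: "\<exists>l\<in>K - {j}. D (g j) l + g l $ s = g j $ s" for s
  proof -
    obtain l where "l \<in> K" "D (g j) l + g l $ s = g j $ s"
      using trop_comb_attained[of K "D (g j)" g s] K_nonempty
        trop_comb_D[OF gen_in_column_space[OF assms]] by auto
    with neg show ?thesis
      by (cases "l = j") auto
  qed
  then have ne: "K - {j} \<noteq> {}"
    by blast
  have "g j = trop_comb (K - {j}) g (D (g j))"
    using attained D_gen_le[OF _ assms] ne by (subst eq_trop_comb_iff) auto
  then have "g j \<in> trop_span (g ` (K - {j}))"
    using trop_comb_in_span[OF _ ne, of g "D (g j)"] by simp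
  then show False
    using irredundant[OF assms] by contradiction
qed

definition u :: "'n \<Rightarrow> real" where
  "u j = (\<Sum>s\<in>UNIV. g j $ s) / CARD('n)"

text \<open>
  Averaging \<open>D (g j) i \<le> g j $ s - g i $ s\<close> over \<open>s\<close> gives \<open>D (g j) i \<le> u j - u i\<close>, and equality
  would make \<open>g j\<close> a multiple of \<open>g i\<close>.
\<close>

lemma D_gen_less:
  assumes "i \<in> K" "j \<in> K" "i \<noteq> j"
  shows "D (g j) i < u j - u i"
proof -
  have le: "D (g j) i \<le> g j $ s - g i $ s" for s
    using D_gen_le[OF assms(1,2), of s] by linarith
  have "\<exists>s. D (g j) i < g j $ s - g i $ s"
  proof (rule ccontr)
    assume "\<nexists>s. D (g j) i < g j $ s - g i $ s"
    then have "D (g j) i = g j $ s - g i $ s" for s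
      using le by (meson antisym_conv1)
    then have "g j $ s = D (g j) i + g i $ s" for s
      by (simp add: algebra_simps)
    then have "g j = (\<chi> s. D (g j) i + g i $ s)"
      by (simp add: vec_eq_iff)
    moreover have "(\<chi> s. D (g j) i + g i $ s) \<in> trop_span (g ` (K - {j}))"
      by (intro trop_span.scale trop_span.gen) (use assms in auto)
    ultimately show False
      using irredundant[OF assms(2)] by simp
  qed
  then have "(\<Sum>s\<in>(UNIV :: 'n set). D (g j) i) < (\<Sum>s\<in>UNIV. g j $ s - g i $ s)"
    using le by (intro sum_strict_mono_ex1) auto
  then show ?thesis
    unfolding u_def by (simp add: sum_subtractf field_simps)
qed

text \<open>\<open>D (trop_comb K g y)\<close> is \<open>P y\<close>, whose \<open>i\<close>-th
  entry is the maximum of \<open>P i j + y j\<close> over \<open>j\<close>. By hypothesis and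
  \<open>P i i = 0\<close>, it is attained at \<open>j = i\<close>.\<close>

lemma D_trop_comb:
  assumes "i \<in> K" "\<And>j. j \<in> K \<Longrightarrow> D (g j) i + y j \<le> y i"
  shows "D (trop_comb K g y) i = y i"
proof (rule antisym)
  obtain c s where cs: "R i c + B $ c $ s + trop_comb K g y $ s = D (trop_comb K g y) i"
    using D_attained by blast
  obtain j where "j \<in> K" "y j + g j $ s = trop_comb K g y $ s"
    using trop_comb_attained[of K y g s] K_nonempty by auto
  then show "D (trop_comb K g y) i \<le> y i"
    using cs assms(2)[of j] D_ge[of i c s "g j"] by linarith
next
  obtain c s where cs: "R i c + B $ c $ s + g i $ s = D (g i) i"
    using D_attained by blast
  then show "y i \<le> D (trop_comb K g y) i"
    using D_ge[of i c s "trop_comb K g y"] trop_comb_ge[of K i y g s] D_gen_self assms(1) by simp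
qed

lemma factors_through_card: "factors_through (card K) N"
proof -
  obtain h where h: "bij_betw h {..<card K} K"
    using ex_bij_betw_nat_finite[of K] by (auto simp: atLeast0LessThan)
  have "N $ i $ j = (MAX l\<in>{..<card K}. g (h l) $ i + R (h l) j)" for i j
  proof -
    have "(\<lambda>l. g l $ i + R l j) ` K = (\<lambda>l. g l $ i + R l j) ` h ` {..<card K}"
      using bij_betw_imp_surj_on[OF h] by simp
    then show ?thesis
      unfolding R[of i j] by (simp only: image_image)
  qed
  moreover have "0 < card K"
    using K_nonempty by (simp add: card_gt_0_iff)
  ultimately show ?thesis
    unfolding factors_through_def by (intro conjI exI[of _ "\<lambda>i l. g (h l) $ i"]
        exI[of _ "\<lambda>l j. R (h l) j"]) auto
qed

lemma ex_dominant_minor: "\<exists>r c a b. dominant_minor N K r c a b"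
proof -
  have "\<forall>j\<in>K. \<exists>c s. R j c + B $ c $ s + g j $ s = 0"
    using D_attained D_gen_self by metis
  then obtain c r where cr: "\<And>j. j \<in> K \<Longrightarrow> R j (c j) + B $ c j $ r j + g j $ r j = 0"
    by metis
  \<comment> \<open>With this scaling \<open>N $ r i $ c j - a i - b j\<close> becomes
    \<open>g j $ r i - g i $ r i - (u j - u i)\<close>, which is 0 for \<open>i = j\<close> and
    negative otherwise by the strict inequality for the potential \<open>u\<close>.\<close>
  define a where "a i = g i $ r i - u i" for i
  define b where "b j = u j - (B $ c j $ r j + g j $ r j)" for j
  \<comment> \<open>Column \<open>c j\<close> of \<open>N\<close> is a multiple of
    \<open>g j\<close>: \<open>N = G R\<close> bounds it below, \<open>N B g j = g j\<close> above,
    and the bounds meet by the choice of \<open>c j\<close> and \<open>r j\<close>.\<close>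
  have N: "N $ s $ c j = g j $ s - (B $ c j $ r j + g j $ r j)" if j: "j \<in> K" for s j
    using regular_column_space(1)[OF regular gen_in_column_space[OF j], of s "c j" "r j"]
      R_le[OF j, of s "c j"] cr[OF j] by linarith
  have "dominant_minor N K r c a b"
    unfolding dominant_minor_def
  proof (intro conjI ballI impI)
    fix i assume "i \<in> K"
    then show "N $ r i $ c i = a i + b i"
      by (simp add: N a_def b_def)
  next
    fix i j assume ij: "i \<in> K" "j \<in> K" "i \<noteq> j"
    have "g j $ r i - g i $ r i \<le> D (g j) i"
      using D_ge[of i "c i" "r i" "g j"] cr[OF ij(1)] by linarith
    then show "N $ r i $ c j < a i + b j"
      using D_gen_less[OF ij] by (simp add: N[OF ij(2)] a_def b_def)
  qed
  then show ?thesis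
    by blast
qed

end

section \<open>Transposition and associativity of the tropical product\<close>

lemma transpose_trop_mult: "transpose (X \<otimes>\<^sub>T Y) = transpose Y \<otimes>\<^sub>T transpose X"
  unfolding trop_mult_def transpose_def by (simp add: vec_eq_iff add.commute)

text \<open>Addition distributes over maxima. Both bracketings of a triple product thereby become a
  maximum over pairs of inner indices.\<close>

lemma MAX_add_MAX_right:
  fixes f :: "'i::finite \<Rightarrow> real" and g :: "'i \<Rightarrow> 'j::finite \<Rightarrow> real"
  shows "(MAX k. f k + (MAX l. g k l)) = (MAX p. f (fst p) + g (fst p) (snd p))"
proof (subst eq_MAX_iff, goal_cases)
  case 3
  have g: "g k l \<le> (MAX l. g k l)" for k l
    by (rule Max_ge) auto
  have f: "f k + (MAX l. g k l) \<le> (MAX k. f k + (MAX l. g k l))" for k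
    by (rule Max_ge) auto
  obtain k where k: "f k + (MAX l. g k l) = (MAX k. f k + (MAX l. g k l))"
    using MAX_attained[of UNIV "\<lambda>k. f k + (MAX l. g k l)"] by auto
  obtain l where "g k l = (MAX l. g k l)"
    using MAX_attained[of UNIV "g k"] by auto
  with k have "\<exists>p. f (fst p) + g (fst p) (snd p) = (MAX k. f k + (MAX l. g k l))"
    by (intro exI[of _ "(k, l)"]) simp
  moreover have "f (fst p) + g (fst p) (snd p) \<le> (MAX k. f k + (MAX l. g k l))" for p
    using g[of "fst p" "snd p"] f[of "fst p"] by linarith
  ultimately show ?case
    by blast
qed auto

lemma trop_mult_assoc: "X \<otimes>\<^sub>T Y \<otimes>\<^sub>T Z = X \<otimes>\<^sub>T (Y \<otimes>\<^sub>T (Z :: real^'n^'n))"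
proof -
  have "(MAX l. (MAX k. X $ i $ k + Y $ k $ l) + Z $ l $ j)
      = (MAX k. X $ i $ k + (MAX l. Y $ k $ l + Z $ l $ j))" for i j
  proof -
    have "(MAX l. (MAX k. X $ i $ k + Y $ k $ l) + Z $ l $ j)
        = (MAX p. Z $ fst p $ j + (X $ i $ snd p + Y $ snd p $ fst p))"
      using MAX_add_MAX_right[of "\<lambda>l. Z $ l $ j" "\<lambda>l k. X $ i $ k + Y $ k $ l"]
      by (simp add: add.commute)
    also have "range (\<lambda>p. Z $ fst p $ j + (X $ i $ snd p + Y $ snd p $ fst p))
        = range (\<lambda>p. X $ i $ fst p + (Y $ fst p $ snd p + Z $ snd p $ j))"
      by (rule set_eqI) (force simp: image_iff algebra_simps)
    also have "(MAX p. X $ i $ fst p + (Y $ fst p $ snd p + Z $ snd p $ j))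
        = (MAX k. X $ i $ k + (MAX l. Y $ k $ l + Z $ l $ j))"
      using MAX_add_MAX_right[of "\<lambda>k. X $ i $ k" "\<lambda>k l. Y $ k $ l + Z $ l $ j"] by simp
    finally show ?thesis .
  qed
  then show ?thesis
    unfolding trop_mult_def by (simp add: vec_eq_iff)
qed

lemma von_neumann_regular_transpose:
  assumes "von_neumann_regular M"
  shows "von_neumann_regular (transpose M)"
proof -
  obtain B where "M \<otimes>\<^sub>T B \<otimes>\<^sub>T M = M"
    using assms unfolding von_neumann_regular_def by blast
  then have "transpose M = transpose M \<otimes>\<^sub>T transpose B \<otimes>\<^sub>T transpose M"
    by (metis transpose_trop_mult trop_mult_assoc)
  then show ?thesis
    unfolding von_neumann_regular_def by metis
qed

section \<open>Factorizations and dominant minors\<close>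

lemma ex_maximal:
  fixes f :: "'i \<Rightarrow> 'b::linorder"
  assumes "finite K" "K \<noteq> {}"
  shows "\<exists>p\<in>K. \<forall>i\<in>K. f i \<le> f p"
  using MAX_attained[OF assms, of f] eq_MAX_iff[OF assms, of _ f] by metis

lemma dominant_minorD:
  assumes "dominant_minor M K r c a b"
  shows "i \<in> K \<Longrightarrow> M $ r i $ c i = a i + b i"
    and "i \<in> K \<Longrightarrow> j \<in> K \<Longrightarrow> i \<noteq> j \<Longrightarrow> M $ r i $ c j < a i + b j"
    and "i \<in> K \<Longrightarrow> j \<in> K \<Longrightarrow> M $ r i $ c j \<le> a i + b j"
proof -
  show "i \<in> K \<Longrightarrow> M $ r i $ c i = a i + b i"
    and less: "i \<in> K \<Longrightarrow> j \<in> K \<Longrightarrow> i \<noteq> j \<Longrightarrow> M $ r i $ c j < a i + b j"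
    using assms unfolding dominant_minor_def by blast+
  then show "i \<in> K \<Longrightarrow> j \<in> K \<Longrightarrow> M $ r i $ c j \<le> a i + b j"
    by (cases "i = j") (auto intro: less_imp_le)
qed

lemma dominant_minor_transpose:
  "dominant_minor M K r c a b \<Longrightarrow> dominant_minor (transpose M) K c r b a"
  unfolding dominant_minor_def transpose_def by (auto simp: add.commute)

text \<open>Two indices with the same row would give both \<open>a j < a i\<close> and
  \<open>a i < a j\<close>.\<close>

lemma dominant_minor_inj:
  assumes "dominant_minor M K r c a b"
  shows "inj_on r K"
proof (rule inj_onI, rule ccontr)
  fix i j assume ij: "i \<in> K" "j \<in> K" "r i = r j" "i \<noteq> j"
  then show False
    using dominant_minorD(1)[OF assms, of i] dominant_minorD(1)[OF assms, of j]
      dominant_minorD(2)[OF assms, of i j] dominant_minorD(2)[OF assms, of j i] by auto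
qed

lemma dominant_minor_reindex:
  assumes "dominant_minor M K r c a b" "inj_on h J" "h ` J \<subseteq> K"
  shows "dominant_minor M J (r \<circ> h) (c \<circ> h) (a \<circ> h) (b \<circ> h)"
  unfolding dominant_minor_def
proof (intro conjI ballI impI)
  fix i assume "i \<in> J"
  then show "M $ (r \<circ> h) i $ (c \<circ> h) i = (a \<circ> h) i + (b \<circ> h) i"
    using dominant_minorD(1)[OF assms(1), of "h i"] assms(3) by auto
next
  fix i j assume "i \<in> J" "j \<in> J" "i \<noteq> j"
  then have "h i \<in> K" "h j \<in> K" "h i \<noteq> h j"
    using assms(2,3) by (auto dest: inj_onD)
  then show "M $ (r \<circ> h) i $ (c \<circ> h) j < (a \<circ> h) i + (b \<circ> h) j"
    using dominant_minorD(2)[OF assms(1)] by simp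
qed

lemma factors_through_transpose:
  assumes "factors_through k M"
  shows "factors_through k (transpose M)"
proof -
  obtain B C where "k > 0" "\<forall>i j. M $ i $ j = (MAX l\<in>{..<k}. B i l + C l j)"
    using assms unfolding factors_through_def by blast
  then show ?thesis
    unfolding factors_through_def transpose_def
    by (intro conjI exI[of _ "\<lambda>i l. C l i"] exI[of _ "\<lambda>l j. B j l"])
      (simp_all add: add.commute[of "C _ _"])
qed

lemma factors_throughE:
  assumes "factors_through k M"
  obtains B C where "k > 0" "\<And>i j l. l < k \<Longrightarrow> B i l + C l j \<le> M $ i $ j"
    "\<And>i j. \<exists>l<k. B i l + C l j = M $ i $ j"
proof -
  obtain B C where k: "k > 0" and M: "\<And>i j. M $ i $ j = (MAX l\<in>{..<k}. B i l + C l j)"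
    using assms unfolding factors_through_def by blast
  have "{..<k} \<noteq> {}"
    using k by auto
  then have "(\<forall>l\<in>{..<k}. B i l + C l j \<le> M $ i $ j) \<and> (\<exists>l\<in>{..<k}. B i l + C l j = M $ i $ j)" for i j
    using M[of i j] by (subst (asm) eq_MAX_iff) auto
  then show ?thesis
    using k by (intro that[of B C]) fastforce+
qed

text \<open>
  If the terms of a factorization attaining two diagonal entries had the same inner index,
  exchanging them would contradict the strict inequalities.
\<close>

lemma card_dominant_minor_le:
  assumes minor: "dominant_minor M K r c a b" and "factors_through f M"
  shows "card K \<le> f"
proof -
  obtain B C where B: "\<And>i j l. l < f \<Longrightarrow> B i l + C l j \<le> M $ i $ j"
    "\<And>i j. \<exists>l<f. B i l + C l j = M $ i $ j"
    using factors_throughE[OF assms(2)] by metis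
  have "\<forall>i. \<exists>l<f. B (r i) l + C l (c i) = M $ r i $ c i"
    using B(2) by blast
  then obtain l where l: "\<And>i. l i < f" "\<And>i. B (r i) (l i) + C (l i) (c i) = M $ r i $ c i"
    by metis
  have "inj_on l K"
  proof (rule inj_onI, rule ccontr)
    fix i j assume ij: "i \<in> K" "j \<in> K" "l i = l j" "i \<noteq> j"
    have "B (r i) (l i) + C (l i) (c j) < a i + b j" "B (r j) (l i) + C (l i) (c i) < a j + b i"
      using B(1)[OF l(1)[of i], of "r i" "c j"] B(1)[OF l(1)[of i], of "r j" "c i"]
        dominant_minorD(2)[OF minor, of i j] dominant_minorD(2)[OF minor, of j i] ij by auto
    moreover have "B (r i) (l i) + C (l i) (c i) = a i + b i" "B (r j) (l i) + C (l i) (c j) = a j + b j"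
      using l(2)[of i] l(2)[of j] ij dominant_minorD(1)[OF minor] by auto
    ultimately show False
      by linarith
  qed
  then have "card K \<le> card {..<f}"
    by (rule card_inj_on_le) (use l in auto)
  then show ?thesis
    by simp
qed

lemma factor_rank_eq:
  assumes "dominant_minor M K r c a b" "factors_through (card K) M"
  shows "factor_rank M = card K"
  unfolding factor_rank_def factors_through_def[symmetric]
  by (rule Least_equality) (use assms card_dominant_minor_le in auto)

section \<open>Determinantal rank\<close>

text \<open>Pigeonhole: with fewer than \<open>k\<close> inner indices, two rows \<open>p\<close>
  and \<open>q\<close> attain the entries selected by \<open>\<sigma>\<close> at the same inner
  index. Exchanging the images of \<open>p\<close> and \<open>q\<close> flips the parity and only
  permutes the terms from \<open>C\<close>, so the sum does not decrease.\<close>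

lemma exchange_permutation:
  fixes A :: "nat \<Rightarrow> nat \<Rightarrow> real"
  assumes le: "\<And>i j l. i < k \<Longrightarrow> j < k \<Longrightarrow> l < f \<Longrightarrow> B i l + C l j \<le> A i j"
    and attained: "\<And>i j. i < k \<Longrightarrow> j < k \<Longrightarrow> \<exists>l<f. B i l + C l j = A i j"
    and "f < k" and \<sigma>: "\<sigma> permutes {..<k}"
  obtains \<tau> where "\<tau> permutes {..<k}" "evenperm \<tau> \<longleftrightarrow> \<not> evenperm \<sigma>"
    "(\<Sum>i<k. A i (\<sigma> i)) \<le> (\<Sum>i<k. A i (\<tau> i))"
proof -
  have \<sigma>k: "\<sigma> i < k" if "i < k" for i
    using permutes_in_image[OF \<sigma>, of i] that by simp
  have "\<forall>i. \<exists>l. i < k \<longrightarrow> l < f \<and> B i l + C l (\<sigma> i) = A i (\<sigma> i)"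
    using attained \<sigma>k by blast
  then obtain l where l: "\<And>i. i < k \<Longrightarrow> l i < f" "\<And>i. i < k \<Longrightarrow> B i (l i) + C (l i) (\<sigma> i) = A i (\<sigma> i)"
    by metis
  have "\<not> inj_on l {..<k}"
  proof
    assume "inj_on l {..<k}"
    then have "card {..<k} \<le> card {..<f}"
      by (rule card_inj_on_le) (use l in auto)
    then show False
      using \<open>f < k\<close> by simp
  qed
  then obtain p q where pq: "p < k" "q < k" "p \<noteq> q" "l p = l q"
    by (auto simp: inj_on_def)
  define t where "t = Transposition.transpose p q"
  have t: "t permutes {..<k}"
    unfolding t_def by (rule permutes_swap_id) (use pq in auto)
  have lt: "l (t i) = l i" for i
    unfolding t_def Transposition.transpose_def using pq(4) by simp
  have perm: "permutation \<sigma>" "permutation t"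
    using \<sigma> t finite_lessThan permutation_permutes by blast+
  show thesis
  proof
    show \<tau>: "\<sigma> \<circ> t permutes {..<k}"
      by (rule permutes_compose[OF t \<sigma>])
    show "evenperm (\<sigma> \<circ> t) \<longleftrightarrow> \<not> evenperm \<sigma>"
      using evenperm_comp[OF perm] evenperm_swap[of p q] pq(3) unfolding t_def by simp
    have "(\<Sum>i<k. C (l i) ((\<sigma> \<circ> t) i)) = (\<Sum>i<k. C (l (t i)) (\<sigma> (t i)))"
      by (simp add: lt)
    also have "\<dots> = (\<Sum>i<k. C (l i) (\<sigma> i))"
      using sum.permute[OF t, of "\<lambda>i. C (l i) (\<sigma> i)"] by (simp add: comp_def)
    finally have "(\<Sum>i<k. A i (\<sigma> i)) = (\<Sum>i<k. B i (l i) + C (l i) ((\<sigma> \<circ> t) i))"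
      using l(2) by (simp add: sum.distrib flip: l(2))
    also have "\<dots> \<le> (\<Sum>i<k. A i ((\<sigma> \<circ> t) i))"
      by (rule sum_mono) (use le l(1) permutes_in_image[OF \<tau>] in auto)
    finally show "(\<Sum>i<k. A i (\<sigma> i)) \<le> (\<Sum>i<k. A i ((\<sigma> \<circ> t) i))" .
  qed
qed

text \<open>By exchange, every even permutation is dominated by an odd one and conversely.\<close>

lemma trop_sums_eq:
  assumes "\<And>i j l. i < k \<Longrightarrow> j < k \<Longrightarrow> l < f \<Longrightarrow> B i l + C l j \<le> A i j"
    and "\<And>i j. i < k \<Longrightarrow> j < k \<Longrightarrow> \<exists>l<f. B i l + C l j = A i j"
    and "f < k"
  shows "trop_even_sum k A = trop_odd_sum k A"
proof -
  have ex: "\<exists>\<tau>. \<tau> permutes {..<k} \<and> evenperm \<tau> = (\<not> evenperm \<sigma>) \<and>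
      ereal (\<Sum>i<k. A i (\<sigma> i)) \<le> ereal (\<Sum>i<k. A i (\<tau> i))"
    if \<sigma>: "\<sigma> permutes {..<k}" for \<sigma>
  proof -
    obtain \<tau> where "\<tau> permutes {..<k}" "evenperm \<tau> \<longleftrightarrow> \<not> evenperm \<sigma>"
      "(\<Sum>i<k. A i (\<sigma> i)) \<le> (\<Sum>i<k. A i (\<tau> i))"
      by (rule exchange_permutation[OF assms \<sigma>])
    then show ?thesis
      by (intro exI[of _ \<tau>]) simp
  qed
  show ?thesis
    unfolding trop_even_sum_def trop_odd_sum_def
  proof (rule antisym; rule SUP_mono)
    fix \<sigma> assume "\<sigma> \<in> {\<sigma>. \<sigma> permutes {..<k} \<and> evenperm \<sigma>}"
    then show "\<exists>\<tau>\<in>{\<sigma>. \<sigma> permutes {..<k} \<and> \<not> evenperm \<sigma>}.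
        ereal (\<Sum>i<k. A i (\<sigma> i)) \<le> ereal (\<Sum>i<k. A i (\<tau> i))"
      using ex[of \<sigma>] by auto
  next
    fix \<sigma> assume "\<sigma> \<in> {\<sigma>. \<sigma> permutes {..<k} \<and> \<not> evenperm \<sigma>}"
    then show "\<exists>\<tau>\<in>{\<sigma>. \<sigma> permutes {..<k} \<and> evenperm \<sigma>}.
        ereal (\<Sum>i<k. A i (\<sigma> i)) \<le> ereal (\<Sum>i<k. A i (\<tau> i))"
      using ex[of \<sigma>] by auto
  qed
qed

text \<open>A finite nonempty supremum is a maximum; \<open>-\<infinity> < v\<close> covers the
  empty index set.\<close>

lemma finite_SUP_less:
  fixes f :: "'i \<Rightarrow> ereal"
  assumes "finite J" "\<And>j. j \<in> J \<Longrightarrow> f j < v" "-\<infinity> < v"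
  shows "(SUP j\<in>J. f j) < v"
  using assms by (induction J rule: finite_induct) (auto simp: bot_ereal_def sup_max)

text \<open>Scaling by \<open>a\<close> and \<open>b\<close> changes all permutation sums by the
  same amount, so the identity, which is even, is strictly best among all permutations.\<close>

lemma trop_sums_dominant_minor:
  assumes minor: "dominant_minor M {..<k} r c a b"
  shows "trop_even_sum k (\<lambda>i j. M $ r i $ c j) \<noteq> trop_odd_sum k (\<lambda>i j. M $ r i $ c j)"
proof -
  let ?v = "\<Sum>i<k. M $ r i $ c i"
  have "ereal ?v \<le> trop_even_sum k (\<lambda>i j. M $ r i $ c j)"
    unfolding trop_even_sum_def by (rule SUP_upper2[of id]) (simp_all add: permutes_id)
  moreover have "trop_odd_sum k (\<lambda>i j. M $ r i $ c j) < ereal ?v"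
    unfolding trop_odd_sum_def
  proof (rule finite_SUP_less)
    show "finite {\<sigma>. \<sigma> permutes {..<k} \<and> \<not> evenperm \<sigma>}"
      by (rule finite_subset[OF _ finite_permutations[of "{..<k}"]]) auto
    fix \<sigma> assume "\<sigma> \<in> {\<sigma>. \<sigma> permutes {..<k} \<and> \<not> evenperm \<sigma>}"
    then have \<sigma>: "\<sigma> permutes {..<k}" and "\<sigma> \<noteq> id"
      by auto
    then obtain p where p: "\<sigma> p \<noteq> p"
      by (metis eq_id_iff)
    then have "p < k"
      using permutes_not_in[OF \<sigma>, of p] by auto
    have \<sigma>k: "\<sigma> i < k" if "i < k" for i
      using permutes_in_image[OF \<sigma>, of i] that by simp
    have "(\<Sum>i<k. M $ r i $ c (\<sigma> i)) < (\<Sum>i<k. a i + b (\<sigma> i))"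
    proof (rule sum_strict_mono_ex1)
      show "\<forall>i\<in>{..<k}. M $ r i $ c (\<sigma> i) \<le> a i + b (\<sigma> i)"
        using dominant_minorD(3)[OF minor] \<sigma>k by simp
      show "\<exists>i\<in>{..<k}. M $ r i $ c (\<sigma> i) < a i + b (\<sigma> i)"
        using dominant_minorD(2)[OF minor, of p "\<sigma> p"] \<sigma>k \<open>p < k\<close> p by auto
    qed simp
    also have "\<dots> = (\<Sum>i<k. a i + b i)"
      using sum.permute[OF \<sigma>, of b] by (simp add: sum.distrib comp_def)
    also have "\<dots> = ?v"
      using dominant_minorD(1)[OF minor] by simp
    finally show "ereal (\<Sum>i<k. M $ r i $ c (\<sigma> i)) < ereal ?v"
      by simp
  qed simp
  ultimately show ?thesis
    by auto
qed

lemma determinantal_rank_eq: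
  fixes M :: "real^'n^'n"
  assumes minor: "dominant_minor M K r c a b" and factors: "factors_through (card K) M"
    and "finite K"
  shows "determinantal_rank M = card K"
  unfolding determinantal_rank_def
proof (rule Max_eqI)
  let ?P = "\<lambda>k. \<exists>(r :: nat \<Rightarrow> 'n) c. inj_on r {..<k} \<and> inj_on c {..<k} \<and>
     trop_even_sum k (\<lambda>i j. M $ r i $ c j) \<noteq> trop_odd_sum k (\<lambda>i j. M $ r i $ c j)"
  \<comment> \<open>The rows of a submatrix are distinct, which bounds its size, so
    \<open>Max\<close> is taken over a finite set.\<close>
  have "{k. ?P k} \<subseteq> {..CARD('n)}"
  proof
    fix k assume "k \<in> {k. ?P k}"
    then obtain r :: "nat \<Rightarrow> 'n" where "inj_on r {..<k}"
      by blast
    then have "card {..<k} \<le> CARD('n)"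
      by (rule card_inj_on_le) auto
    then show "k \<in> {..CARD('n)}"
      by simp
  qed
  then show "finite {k. ?P k}"
    by (rule finite_subset) simp
  obtain h where h: "bij_betw h {..<card K} K"
    using ex_bij_betw_nat_finite[OF \<open>finite K\<close>] by (auto simp: atLeast0LessThan)
  then have minor': "dominant_minor M {..<card K} (r \<circ> h) (c \<circ> h) (a \<circ> h) (b \<circ> h)"
    using minor by (intro dominant_minor_reindex) (auto simp: bij_betw_def)
  then have "?P (card K)"
    using dominant_minor_inj[OF minor'] dominant_minor_inj[OF dominant_minor_transpose[OF minor']]
      trop_sums_dominant_minor[OF minor'] by blast
  then show "card K \<in> {k. ?P k}"
    by simp
  fix k assume "k \<in> {k. ?P k}"
  then obtain r c where ne: "trop_even_sum k (\<lambda>i j. M $ r i $ c j) \<noteq> trop_odd_sum k (\<lambda>i j. M $ r i $ c j)"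
    by blast
  obtain B C where B: "\<And>i j l. l < card K \<Longrightarrow> B i l + C l j \<le> M $ i $ j"
    "\<And>i j. \<exists>l<card K. B i l + C l j = M $ i $ j"
    using factors_throughE[OF factors] by metis
  show "k \<le> card K"
    using ne trop_sums_eq[of k "card K" "\<lambda>i. B (r i)" "\<lambda>l j. C l (c j)" "\<lambda>i j. M $ r i $ c j"] B
    by (metis not_le)
qed

section \<open>Gondran-Minoux rank\<close>

text \<open>Gaussian elimination: if equation \<open>k\<close> has a nonzero coefficient at
  \<open>p\<close>, it eliminates the unknown \<open>p\<close> and leaves \<open>k\<close> equations
  in the other unknowns.\<close>

lemma nontrivial_solution:
  fixes a :: "'i \<Rightarrow> nat \<Rightarrow> 'f::field"
  assumes "finite S" "k < card S"
  shows "\<exists>\<beta>. (\<exists>i\<in>S. \<beta> i \<noteq> 0) \<and> (\<forall>l<k. (\<Sum>i\<in>S. \<beta> i * a i l) = 0)"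
  using assms
proof (induction k arbitrary: S a)
  case 0
  then have "S \<noteq> {}"
    by auto
  then show ?case
    by (intro exI[of _ "\<lambda>_. 1"]) auto
next
  case (Suc k)
  show ?case
  proof (cases "\<forall>i\<in>S. a i k = 0")
    case True
    have "k < card S"
      using Suc.prems by simp
    then obtain \<beta> where \<beta>: "\<exists>i\<in>S. \<beta> i \<noteq> 0" "\<forall>l<k. (\<Sum>i\<in>S. \<beta> i * a i l) = 0"
      using Suc.IH[OF Suc.prems(1)] by blast
    then have "\<forall>l<Suc k. (\<Sum>i\<in>S. \<beta> i * a i l) = 0"
      using True by (auto simp: less_Suc_eq)
    with \<beta>(1) show ?thesis
      by blast
  next
    case False
    then obtain p where p: "p \<in> S" "a p k \<noteq> 0"
      by blast
    define S' where "S' = S - {p}"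
    have S': "finite S'" "k < card S'" "p \<notin> S'" "S = insert p S'"
      using Suc.prems p unfolding S'_def by auto
    obtain \<beta> where \<beta>: "\<exists>i\<in>S'. \<beta> i \<noteq> 0"
        "\<forall>l<k. (\<Sum>i\<in>S'. \<beta> i * (a i l - a i k / a p k * a p l)) = 0"
      using Suc.IH[OF S'(1,2), of "\<lambda>i l. a i l - a i k / a p k * a p l"] by blast
    define \<gamma> where "\<gamma> = \<beta>(p := - (\<Sum>i\<in>S'. \<beta> i * a i k) / a p k)"
    have \<gamma>: "\<gamma> i = \<beta> i" if "i \<in> S'" for i
      using that S'(3) unfolding \<gamma>_def by auto
    have "(\<Sum>i\<in>S. \<gamma> i * a i l) = 0" if l: "l < Suc k" for l
    proof -
      have "(\<Sum>i\<in>S. \<gamma> i * a i l) = \<gamma> p * a p l + (\<Sum>i\<in>S'. \<beta> i * a i l)"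
        using S' \<gamma> by simp
      also have "\<dots> = (\<Sum>i\<in>S'. \<beta> i * (a i l - a i k / a p k * a p l))"
        unfolding \<gamma>_def using p(2)
        by (simp add: sum_subtractf right_diff_distrib sum_distrib_right sum_divide_distrib sum_negf
            mult.assoc)
      also have "\<dots> = 0"
      proof (cases "l = k")
        case True
        then show ?thesis
          using p(2) by simp
      next
        case False
        then show ?thesis
          using \<beta>(2) l by simp
      qed
      finally show ?thesis .
    qed
    moreover have "\<exists>i\<in>S. \<gamma> i \<noteq> 0"
      using \<beta>(1) \<gamma> S'(4) by auto
    ultimately show ?thesis
      by blast
  qed
qed

text \<open>Such a function is the coefficient function of a series, which has a least exponent. The
  real version serves real and imaginary parts.\<close>

lemma least_support:
  fixes f :: "real \<Rightarrow> real"
  assumes "\<And>x. finite {a. a \<le> x \<and> f a \<noteq> 0}" "f x \<noteq> 0"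
  obtains v where "f v \<noteq> 0" "\<And>a. f a \<noteq> 0 \<Longrightarrow> v \<le> a"
proof -
  define F where "F = Abs_pseries (\<lambda>a. complex_of_real (f a))"
  have F: "coeff F a = complex_of_real (f a)" for a
    unfolding F_def by (subst coeff_Abs_pseries) (use assms(1) in simp_all)
  then have "F \<noteq> 0"
    using assms(2) by (auto simp: coeff_simps dest!: arg_cong[of F 0 "\<lambda>F. coeff F x"])
  then show ?thesis
    using coeff_least_exponent that F by (metis of_real_eq_0_iff)
qed

text \<open>
  The vectors with entries \<open>t\<close> to the power \<open>- B i l\<close>, for \<open>l < k\<close>, are linearly dependent over the
  field of series, and the dependence can be chosen with real coefficients. In each coordinate the terms of least exponent
  cancel, so the lowest coefficients have both signs among the indices attaining it.
\<close>

lemma tropical_sign_balance: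
  fixes B :: "'i \<Rightarrow> nat \<Rightarrow> real"
  assumes "finite S" "k < card S"
  obtains P Q x where "P \<subseteq> S" "Q \<subseteq> S" "P \<inter> Q = {}" "P \<union> Q \<noteq> {}"
    "\<And>l i. l < k \<Longrightarrow> i \<in> P \<Longrightarrow> \<exists>j\<in>Q. x i + B i l \<le> x j + B j l"
    "\<And>l j. l < k \<Longrightarrow> j \<in> Q \<Longrightarrow> \<exists>i\<in>P. x j + B j l \<le> x i + B i l"
proof -
  obtain \<beta> where \<beta>: "\<exists>i\<in>S. \<beta> i \<noteq> 0" "\<And>l. l < k \<Longrightarrow> (\<Sum>i\<in>S. \<beta> i * pmonom 1 (- B i l)) = 0"
    using nontrivial_solution[OF assms, of "\<lambda>i l. pmonom 1 (- B i l)"] by blast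
  have eq: "(\<Sum>i\<in>S. coeff (\<beta> i) (x + B i l)) = 0" if "l < k" for l x
  proof -
    have "coeff (\<Sum>i\<in>S. \<beta> i * pmonom 1 (- B i l)) x = 0"
      using \<beta>(2)[OF that] by (simp add: coeff_simps)
    then show ?thesis
      by (simp add: coeff_sum coeff_pmonom_mult mult.commute[of _ "pmonom _ _"])
  qed
  obtain i0 x0 where i0: "i0 \<in> S" "coeff (\<beta> i0) x0 \<noteq> 0"
    using \<beta>(1) pseries_eqI[of _ 0] by (metis zero_pseries.rep_eq)
  \<comment> \<open>The monomials have coefficient 1, so real and imaginary parts satisfy the
    relations separately; the part is chosen so that some coefficient stays nonzero.\<close>
  define part where "part = (if Re (coeff (\<beta> i0) x0) \<noteq> 0 then Re else Im)"
  have part: "part (\<Sum>i\<in>S. f i) = (\<Sum>i\<in>S. part (f i))" "part 0 = 0" for f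
    unfolding part_def by auto
  define c where "c i y = part (coeff (\<beta> i) y)" for i y
  have c_sum: "(\<Sum>i\<in>S. c i (y + B i l)) = 0" if "l < k" for l y
    using eq[OF that, of y] part unfolding c_def by metis
  have c_fin: "finite {a. a \<le> y \<and> c i a \<noteq> 0}" for i y
    by (rule finite_subset[OF _ finite_coeff[of y "\<beta> i"]]) (auto simp: c_def part(2))
  have c0: "c i0 x0 \<noteq> 0"
    using i0(2) unfolding c_def part_def by (auto simp: complex_eq_iff)
  define T where "T = {i \<in> S. \<exists>y. c i y \<noteq> 0}"
  have T: "finite T" "T \<noteq> {}" "T \<subseteq> S"
    using assms(1) i0(1) c0 unfolding T_def by auto
  have "\<exists>v. c i v \<noteq> 0 \<and> (\<forall>a. c i a \<noteq> 0 \<longrightarrow> v \<le> a)" if "i \<in> T" for i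
    using that least_support[OF c_fin, of i] unfolding T_def by blast
  then obtain v where v: "\<And>i. i \<in> T \<Longrightarrow> c i (v i) \<noteq> 0"
    "\<And>i a. i \<in> T \<Longrightarrow> c i a \<noteq> 0 \<Longrightarrow> v i \<le> a"
    by metis
  have balance: "(\<exists>i\<in>T. c i (v i) > 0 \<and> (\<forall>j\<in>T. v i - B i l \<le> v j - B j l))
      \<and> (\<exists>i\<in>T. c i (v i) < 0 \<and> (\<forall>j\<in>T. v i - B i l \<le> v j - B j l))" if l: "l < k" for l
  proof -
    \<comment> \<open>\<open>w\<close> is the least exponent in relation \<open>l\<close>, and only
      indices in \<open>A\<close> contribute to it. Their lowest coefficients are nonzero with sum
      0, so both signs occur.\<close>
    define w where "w = (MIN i\<in>T. v i - B i l)"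
    have w: "w \<le> v i - B i l" if "i \<in> T" for i
      unfolding w_def using T(1) that by (intro Min_le) auto
    define A where "A = {i \<in> T. v i - B i l = w}"
    have "w \<in> (\<lambda>i. v i - B i l) ` T"
      unfolding w_def using T(1,2) by (intro Min_in) auto
    then have A: "finite A" "A \<noteq> {}"
      using T(1) unfolding A_def by auto
    have "c i (w + B i l) = 0" if "i \<in> S - A" for i
    proof (rule ccontr)
      assume nz: "c i (w + B i l) \<noteq> 0"
      then have "i \<in> T"
        using that unfolding T_def by auto
      then have "v i = w + B i l"
        using v(2)[OF _ nz] w[of i] by force
      then show False
        using that \<open>i \<in> T\<close> unfolding A_def by simp
    qed
    then have "(\<Sum>i\<in>A. c i (w + B i l)) = (\<Sum>i\<in>S. c i (w + B i l))"
      using assms(1) T(3) by (intro sum.mono_neutral_left) (auto simp: A_def)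
    moreover have "(\<Sum>i\<in>A. c i (w + B i l)) = (\<Sum>i\<in>A. c i (v i))"
      by (rule sum.cong) (auto simp: A_def)
    ultimately have sum0: "(\<Sum>i\<in>A. c i (v i)) = 0"
      using c_sum[OF l] by simp
    have nz: "c i (v i) \<noteq> 0" if "i \<in> A" for i
      using that v(1) unfolding A_def by simp
    have "\<exists>p\<in>A. c p (v p) > 0"
    proof (rule ccontr)
      assume "\<not> (\<exists>p\<in>A. c p (v p) > 0)"
      then have "\<And>i. i \<in> A \<Longrightarrow> 0 < - c i (v i)"
        using nz by force
      then have "0 < (\<Sum>i\<in>A. - c i (v i))"
        by (rule sum_pos[OF A])
      then show False
        using sum0 by (simp add: sum_negf)
    qed
    then obtain p where p: "p \<in> A" "c p (v p) > 0"
      by blast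
    have "\<exists>q\<in>A. c q (v q) < 0"
    proof (rule ccontr)
      assume "\<not> (\<exists>q\<in>A. c q (v q) < 0)"
      then have "\<And>i. i \<in> A \<Longrightarrow> 0 < c i (v i)"
        using nz by force
      then have "0 < (\<Sum>i\<in>A. c i (v i))"
        by (rule sum_pos[OF A])
      then show False
        using sum0 by simp
    qed
    then obtain q where q: "q \<in> A" "c q (v q) < 0"
      by blast
    have "p \<in> T" "q \<in> T" "v p - B p l = w" "v q - B q l = w"
      using p(1) q(1) unfolding A_def by auto
    then show ?thesis
      using p(2) q(2) w by (intro conjI bexI[of _ p] bexI[of _ q]) auto
  qed
  show thesis
  \<comment> \<open>The sign of the lowest coefficient decides the side. The scalars are negated
    exponents, so least exponents turn into maxima.\<close>
  proof (rule that[of "{i \<in> T. c i (v i) > 0}" "{i \<in> T. c i (v i) < 0}" "\<lambda>i. - v i"])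
    show "{i \<in> T. c i (v i) > 0} \<union> {i \<in> T. c i (v i) < 0} \<noteq> {}"
    proof -
      obtain i where "i \<in> T"
        using T(2) by blast
      then show ?thesis
        using v(1)[of i] by (cases "c i (v i) > 0") (auto simp: not_less le_less)
    qed
  next
    fix l i assume "l < k" and i: "i \<in> {i \<in> T. c i (v i) > 0}"
    then obtain j where "j \<in> T" "c j (v j) < 0" "\<forall>i\<in>T. v j - B j l \<le> v i - B i l"
      using balance[of l] by blast
    then show "\<exists>j\<in>{i \<in> T. c i (v i) < 0}. - v i + B i l \<le> - v j + B j l"
      using i by (intro bexI[of _ j]) auto
  next
    fix l i assume "l < k" and i: "i \<in> {i \<in> T. c i (v i) < 0}"
    then obtain j where "j \<in> T" "c j (v j) > 0" "\<forall>i\<in>T. v j - B j l \<le> v i - B i l"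
      using balance[of l] by blast
    then show "\<exists>j\<in>{i \<in> T. c i (v i) > 0}. - v i + B i l \<le> - v j + B j l"
      using i by (intro bexI[of _ j]) auto
  qed (use T(3) in auto)
qed

text \<open>A balance at each inner index carries over to \<open>M = B C\<close>: an entry on one
  side is attained at some \<open>l\<close>, and there the other side has a row at least as
  large.\<close>

lemma gondran_minoux_dependent_rows:
  fixes M :: "real^'n^'n"
  assumes "factors_through k M" "k < card S"
  shows "gondran_minoux_dependent S (\<lambda>i. row i M)"
proof -
  obtain B C where B: "\<And>i j l. l < k \<Longrightarrow> B i l + C l j \<le> M $ i $ j"
    "\<And>i j. \<exists>l<k. B i l + C l j = M $ i $ j"
    using factors_throughE[OF assms(1)] by metis
  obtain P Q x where PQ: "P \<subseteq> S" "Q \<subseteq> S" "P \<inter> Q = {}" "P \<union> Q \<noteq> {}"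
    and xP: "\<And>l i. l < k \<Longrightarrow> i \<in> P \<Longrightarrow> \<exists>j\<in>Q. x i + B i l \<le> x j + B j l"
    and xQ: "\<And>l j. l < k \<Longrightarrow> j \<in> Q \<Longrightarrow> \<exists>i\<in>P. x j + B j l \<le> x i + B i l"
    using tropical_sign_balance[OF finite assms(2), of B] by metis
  have MP: "\<exists>j\<in>Q. x i + M $ i $ c \<le> x j + M $ j $ c" if i: "i \<in> P" for i c
  proof -
    obtain l where l: "l < k" "B i l + C l c = M $ i $ c"
      using B(2) by blast
    obtain j where "j \<in> Q" "x i + B i l \<le> x j + B j l"
      using xP[OF l(1) i] by blast
    then show ?thesis
      using l(2) B(1)[OF l(1), of j c] by (intro bexI[of _ j]) auto
  qed
  have MQ: "\<exists>j\<in>P. x i + M $ i $ c \<le> x j + M $ j $ c" if i: "i \<in> Q" for i c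
  proof -
    obtain l where l: "l < k" "B i l + C l c = M $ i $ c"
      using B(2) by blast
    obtain j where "j \<in> P" "x i + B i l \<le> x j + B j l"
      using xQ[OF l(1) i] by blast
    then show ?thesis
      using l(2) B(1)[OF l(1), of j c] by (intro bexI[of _ j]) auto
  qed
  \<comment> \<open>Rows outside \<open>P\<close> and \<open>Q\<close> get
    \<open>-\<infinity>\<close>, which lets \<open>S - P\<close> serve as the second index
    set.\<close>
  define \<alpha> where "\<alpha> i = (if i \<in> P \<union> Q then ereal (x i) else -\<infinity>)" for i
  have "(SUP i\<in>P. \<alpha> i + ereal (row i M $ c)) = (SUP j\<in>S - P. \<alpha> j + ereal (row j M $ c))" for c
  proof (rule antisym; rule SUP_least)
    fix i assume i: "i \<in> P"
    obtain j where j: "j \<in> Q" "x i + M $ i $ c \<le> x j + M $ j $ c"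
      using MP[OF i] by blast
    then have "\<alpha> i + ereal (row i M $ c) \<le> \<alpha> j + ereal (row j M $ c)"
      using i unfolding \<alpha>_def row_def by simp
    also have "\<dots> \<le> (SUP j\<in>S - P. \<alpha> j + ereal (row j M $ c))"
      by (rule SUP_upper) (use j PQ in auto)
    finally show "\<alpha> i + ereal (row i M $ c) \<le> (SUP j\<in>S - P. \<alpha> j + ereal (row j M $ c))" .
  next
    fix i assume i: "i \<in> S - P"
    show "\<alpha> i + ereal (row i M $ c) \<le> (SUP j\<in>P. \<alpha> j + ereal (row j M $ c))"
    proof (cases "i \<in> Q")
      case True
      obtain j where j: "j \<in> P" "x i + M $ i $ c \<le> x j + M $ j $ c"
        using MQ[OF True] by blast
      then have "\<alpha> i + ereal (row i M $ c) \<le> \<alpha> j + ereal (row j M $ c)"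
        using True unfolding \<alpha>_def row_def by simp
      also have "\<dots> \<le> (SUP j\<in>P. \<alpha> j + ereal (row j M $ c))"
        by (rule SUP_upper) (use j in auto)
      finally show ?thesis .
    next
      case False
      then show ?thesis
        using i unfolding \<alpha>_def by simp
    qed
  qed
  moreover have "\<forall>i\<in>S. \<alpha> i \<noteq> \<infinity>" "\<exists>i\<in>S. \<alpha> i \<noteq> -\<infinity>"
    using PQ unfolding \<alpha>_def by auto
  ultimately show ?thesis
    unfolding gondran_minoux_dependent_def using PQ(1)
    by (intro exI[of _ P] exI[of _ "S - P"] exI[of _ \<alpha>]) auto
qed

text \<open>Let \<open>p\<close> maximize \<open>x i + a i\<close>. In column \<open>c p\<close> the
  term of row \<open>p\<close> strictly exceeds all others, so the side containing \<open>p\<close>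
  is larger.\<close>

lemma gondran_minoux_independent_rows:
  fixes M :: "real^'n^'n"
  assumes "dominant_minor M S (\<lambda>i. i) c a b"
  shows "\<not> gondran_minoux_dependent S (\<lambda>i. row i M)"
proof
  assume "gondran_minoux_dependent S (\<lambda>i. row i M)"
  then obtain I J \<alpha> where IJ: "I \<inter> J = {}" "I \<union> J = S"
    and \<alpha>: "\<forall>i\<in>S. \<alpha> i \<noteq> \<infinity>" "\<exists>i\<in>S. \<alpha> i \<noteq> -\<infinity>"
    and eq: "\<And>d. (SUP i\<in>I. \<alpha> i + ereal (row i M $ d)) = (SUP j\<in>J. \<alpha> j + ereal (row j M $ d))"
    unfolding gondran_minoux_dependent_def by blast
  define T where "T = {i \<in> S. \<alpha> i \<noteq> -\<infinity>}"
  define x where "x i = real_of_ereal (\<alpha> i)" for i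
  have x: "\<alpha> i = ereal (x i)" if "i \<in> T" for i
    using that \<alpha>(1) unfolding T_def x_def by (auto simp: ereal_real)
  have "T \<noteq> {}"
    using \<alpha>(2) unfolding T_def by blast
  then obtain p where p: "p \<in> T" "\<And>i. i \<in> T \<Longrightarrow> x i + a i \<le> x p + a p"
    using ex_maximal[of T "\<lambda>i. x i + a i"] by auto
  have "p \<in> S"
    using p(1) unfolding T_def by simp
  let ?v = "\<alpha> p + ereal (row p M $ c p)"
  have v: "?v = ereal (x p + a p + b p)"
    using x[OF p(1)] dominant_minorD(1)[OF assms \<open>p \<in> S\<close>] unfolding row_def by simp
  have less: "\<alpha> i + ereal (row i M $ c p) < ?v" if "i \<in> S" "i \<noteq> p" for i
  proof (cases "i \<in> T")
    case True
    then show ?thesis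
      using p(2)[OF True] dominant_minorD(2)[OF assms that(1) \<open>p \<in> S\<close> that(2)]
      unfolding v x[OF True] by (simp add: row_def)
  next
    case False
    then show ?thesis
      using that(1) unfolding T_def v by simp
  qed
  have contra: False if "A \<subseteq> S" "A' \<subseteq> S" "p \<in> A" "p \<notin> A'"
    "(SUP i\<in>A. \<alpha> i + ereal (row i M $ c p)) = (SUP j\<in>A'. \<alpha> j + ereal (row j M $ c p))" for A A'
  proof -
    have "(SUP j\<in>A'. \<alpha> j + ereal (row j M $ c p)) < ?v"
      by (rule finite_SUP_less) (use that less v in auto)
    moreover have "?v \<le> (SUP i\<in>A. \<alpha> i + ereal (row i M $ c p))"
      by (rule SUP_upper[OF that(3)])
    ultimately show False
      using that(5) by simp
  qed
  show False
    using contra[of I J] contra[of J I] IJ \<open>p \<in> S\<close> eq[of "c p"] by auto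
qed

lemma gondran_minoux_row_rank_eq:
  fixes M :: "real^'n^'n"
  assumes minor: "dominant_minor M K r c a b" and factors: "factors_through (card K) M"
  shows "gondran_minoux_row_rank M = card K"
  unfolding gondran_minoux_row_rank_def
proof (rule Max_eqI)
  let ?D = "\<lambda>S. gondran_minoux_dependent S (\<lambda>i. row i M)"
  have "{card S |S. \<not> ?D S} \<subseteq> card ` (UNIV :: 'n set set)"
    by auto
  then show "finite {card S |S. \<not> ?D S}"
    by (rule finite_subset) simp
  have inj: "inj_on r K"
    using minor by (rule dominant_minor_inj)
  \<comment> \<open>The minor is reindexed by its own rows, since the rank counts sets of row
    indices.\<close>
  have "dominant_minor M (r ` K) (r \<circ> inv_into K r) (c \<circ> inv_into K r) (a \<circ> inv_into K r)
      (b \<circ> inv_into K r)"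
    using minor by (rule dominant_minor_reindex) (auto simp: inj_on_inv_into inv_into_into)
  then have "dominant_minor M (r ` K) (\<lambda>i. i) (c \<circ> inv_into K r) (a \<circ> inv_into K r)
      (b \<circ> inv_into K r)"
    unfolding dominant_minor_def by (auto simp: f_inv_into_f)
  then have "\<not> ?D (r ` K)"
    by (rule gondran_minoux_independent_rows)
  then show "card K \<in> {card S |S. \<not> ?D S}"
    using card_image[OF inj] by (intro CollectI exI[of _ "r ` K"]) auto
  fix k assume "k \<in> {card S |S. \<not> ?D S}"
  then show "k \<le> card K"
    using gondran_minoux_dependent_rows[OF factors] by force
qed

section \<open>Kapranov rank\<close>

lemma val_eqI:
  assumes "coeff f b \<noteq> 0" "\<And>a. coeff f a \<noteq> 0 \<Longrightarrow> b \<le> a"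
  shows "val f = b"
  unfolding val_def by (rule Least_equality) (use assms in auto)

lemma coeff_val:
  assumes "f \<noteq> 0"
  shows "coeff f (val f) \<noteq> 0" and "coeff f a \<noteq> 0 \<Longrightarrow> val f \<le> a"
proof -
  obtain b where b: "coeff f b \<noteq> 0" "\<And>a. coeff f a \<noteq> 0 \<Longrightarrow> b \<le> a"
    using coeff_least_exponent[OF assms] by blast
  then have "val f = b"
    by (rule val_eqI)
  with b show "coeff f (val f) \<noteq> 0" "coeff f a \<noteq> 0 \<Longrightarrow> val f \<le> a"
    by auto
qed

lemma coeff_times_below:
  assumes "f \<noteq> 0" "g \<noteq> 0" "x < val f + val g"
  shows "coeff (f * g) x = 0"
proof -
  have "coeff f a = 0 \<or> coeff g (x - a) = 0" for a
    using coeff_val(2)[OF assms(1), of a] coeff_val(2)[OF assms(2), of "x - a"] assms(3) by force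
  then show ?thesis
    unfolding coeff_times by (intro sum.neutral) auto
qed

lemma coeff_times_val:
  assumes "f \<noteq> 0" "g \<noteq> 0"
  shows "coeff (f * g) (val f + val g) = coeff f (val f) * coeff g (val g)"
proof (subst coeff_times_superset[of "{val f}"])
  fix a assume "coeff f a \<noteq> 0" "coeff g (val f + val g - a) \<noteq> 0"
  then show "a \<in> {val f}"
    using coeff_val(2)[OF assms(1), of a] coeff_val(2)[OF assms(2), of "val f + val g - a"] by simp
qed simp_all

text \<open>Let \<open>p\<close> maximize \<open>a i - val (\<beta> i)\<close> among the nonzero
  \<open>\<beta> i\<close>. In column \<open>c p\<close> the term of \<open>p\<close> alone has the
  lowest exponent, so it cannot cancel.\<close>

lemma dominant_minor_lift_independent:
  fixes F :: "pseries^'n^'n"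
  assumes minor: "dominant_minor M K r c a b" and "finite K"
    and F: "\<And>i j. F $ i $ j \<noteq> 0" "\<And>i j. - val (F $ i $ j) = M $ i $ j"
    and sum: "\<And>j. (\<Sum>i\<in>K. \<beta> i * F $ r i $ j) = 0"
    and "i \<in> K"
  shows "\<beta> i = 0"
proof (rule ccontr)
  assume "\<beta> i \<noteq> 0"
  define T where "T = {i \<in> K. \<beta> i \<noteq> 0}"
  have "finite T" "T \<noteq> {}"
    using \<open>finite K\<close> \<open>i \<in> K\<close> \<open>\<beta> i \<noteq> 0\<close> unfolding T_def by auto
  then obtain p where p: "p \<in> T" "\<And>i. i \<in> T \<Longrightarrow> a i - val (\<beta> i) \<le> a p - val (\<beta> p)"
    using ex_maximal[of T "\<lambda>i. a i - val (\<beta> i)"] by auto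
  have p': "p \<in> K" "\<beta> p \<noteq> 0"
    using p(1) unfolding T_def by auto
  let ?v = "val (\<beta> p) + val (F $ r p $ c p)"
  have v: "?v = val (\<beta> p) - a p - b p"
    using dominant_minorD(1)[OF minor p'(1)] F(2)[of "r p" "c p"] by simp
  have "coeff (\<beta> i * F $ r i $ c p) ?v = 0" if i: "i \<in> K" "i \<noteq> p" for i
  proof (cases "\<beta> i = 0")
    case True
    then show ?thesis
      by (simp add: coeff_simps)
  next
    case False
    then have "i \<in> T"
      using i unfolding T_def by simp
    have "?v < val (\<beta> i) + val (F $ r i $ c p)"
      using p(2)[OF \<open>i \<in> T\<close>] dominant_minorD(2)[OF minor i(1) p'(1) i(2)] F(2)[of "r i" "c p"]
      unfolding v by linarith
    then show ?thesis
      by (rule coeff_times_below[OF False F(1)])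
  qed
  then have "(\<Sum>i\<in>K. coeff (\<beta> i * F $ r i $ c p) ?v) = coeff (\<beta> p * F $ r p $ c p) ?v"
    using \<open>finite K\<close> p'(1) by (subst sum.remove[of _ p]) (auto intro!: sum.neutral)
  moreover have "(\<Sum>i\<in>K. coeff (\<beta> i * F $ r i $ c p) ?v) = 0"
    using sum[of "c p"] by (simp add: coeff_sum[symmetric] coeff_simps)
  moreover have "coeff (\<beta> p * F $ r p $ c p) ?v \<noteq> 0"
    unfolding coeff_times_val[OF p'(2) F(1)] using coeff_val(1)[OF p'(2)] coeff_val(1)[OF F(1)] by simp
  ultimately show False
    by simp
qed

text \<open>Expand the rows in a basis of \<open>rank F\<close> rows; the coefficient vectors are
  dependent because \<open>card K\<close> exceeds their length.\<close>

lemma rows_dependent_of_rank_less: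
  fixes F :: "'f::field^'n^'m" and r :: "'i \<Rightarrow> 'm"
  assumes "finite K" "rank F < card K"
  obtains \<beta> where "\<exists>i\<in>K. \<beta> i \<noteq> 0" "\<And>j. (\<Sum>i\<in>K. \<beta> i * F $ r i $ j) = 0"
proof -
  obtain B where B: "B \<subseteq> rows F" "vec.independent B" "rows F \<subseteq> vec.span B" "card B = rank F"
    unfolding row_rank_def_gen using vec.basis_exists[of "rows F"] by metis
  have "finite B"
    using B(2) by (rule vec.finiteI_independent)
  obtain h where h: "bij_betw h {..<card B} B"
    using ex_bij_betw_nat_finite[OF \<open>finite B\<close>] by (auto simp: atLeast0LessThan)
  have "\<exists>u. row (r i) F = (\<Sum>v\<in>B. u v *s v)" for i
  proof -
    have "row (r i) F \<in> vec.span B"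
      using B(3) unfolding rows_def by blast
    then show ?thesis
      unfolding vec.span_finite[OF \<open>finite B\<close>] by auto
  qed
  then obtain u where u: "\<And>i. row (r i) F = (\<Sum>v\<in>B. u i v *s v)"
    by metis
  obtain \<beta> where \<beta>: "\<exists>i\<in>K. \<beta> i \<noteq> 0" "\<And>l. l < card B \<Longrightarrow> (\<Sum>i\<in>K. \<beta> i * u i (h l)) = 0"
    using nontrivial_solution[OF assms(1), of "card B" "\<lambda>i l. u i (h l)"] assms(2) B(4) by auto
  have \<beta>0: "(\<Sum>i\<in>K. \<beta> i * u i v) = 0" if "v \<in> B" for v
  proof -
    have "v \<in> h ` {..<card B}"
      using that bij_betw_imp_surj_on[OF h] by simp
    then show ?thesis
      using \<beta>(2) by auto
  qed
  have "(\<Sum>i\<in>K. \<beta> i * F $ r i $ j) = 0" for j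
  proof -
    have "F $ r i $ j = (\<Sum>v\<in>B. u i v * v $ j)" for i
    proof -
      have "F $ r i $ j = row (r i) F $ j"
        by (simp add: row_def)
      also have "\<dots> = (\<Sum>v\<in>B. u i v * v $ j)"
        unfolding u by simp
      finally show ?thesis .
    qed
    then have "(\<Sum>i\<in>K. \<beta> i * F $ r i $ j) = (\<Sum>i\<in>K. \<Sum>v\<in>B. \<beta> i * u i v * v $ j)"
      by (simp add: sum_distrib_left mult.assoc)
    also have "\<dots> = (\<Sum>v\<in>B. (\<Sum>i\<in>K. \<beta> i * u i v) * v $ j)"
      by (subst sum.swap) (simp add: sum_distrib_right)
    also have "\<dots> = 0"
      using \<beta>0 by simp
    finally show ?thesis .
  qed
  then show thesis
    using that \<beta>(1) by blast
qed

text \<open>Lift both factors to monomials with coefficient 1. The coefficients of the product count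
  inner indices, so nothing cancels and the valuations are as required; its rows are combinations of
  \<open>k\<close> vectors.\<close>

lemma ex_lift_rank_le:
  fixes M :: "real^'n^'n"
  assumes "factors_through k M"
  obtains F :: "pseries^'n^'n" where "\<And>i j. F $ i $ j \<noteq> 0" "\<And>i j. - val (F $ i $ j) = M $ i $ j"
    "rank F \<le> k"
proof -
  obtain B C where B: "\<And>i j l. l < k \<Longrightarrow> B i l + C l j \<le> M $ i $ j"
    "\<And>i j. \<exists>l<k. B i l + C l j = M $ i $ j"
    using factors_throughE[OF assms] by metis
  define F :: "pseries^'n^'n" where "F = (\<chi> i j. \<Sum>l<k. pmonom 1 (- B i l) * pmonom 1 (- C l j))"
  have coeff_F: "coeff (F $ i $ j) y = of_nat (card {l. l < k \<and> - (B i l + C l j) = y})" for i j y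
  proof -
    have "coeff (F $ i $ j) y = (\<Sum>l<k. if - (B i l + C l j) = y then 1 else 0)"
      unfolding F_def by (simp add: coeff_sum coeff_pmonom_mult pmonom.rep_eq)
        (intro sum.cong refl, auto)
    also have "\<dots> = of_nat (card {l \<in> {..<k}. - (B i l + C l j) = y})"
      by (simp add: sum.inter_filter[symmetric])
    finally show ?thesis
      by simp
  qed
  have nz: "coeff (F $ i $ j) (- M $ i $ j) \<noteq> 0" for i j
    using B(2)[of i j] unfolding coeff_F by auto
  have low: "- M $ i $ j \<le> y" if "coeff (F $ i $ j) y \<noteq> 0" for i j y
  proof -
    have "{l. l < k \<and> - (B i l + C l j) = y} \<noteq> {}"
      using that unfolding coeff_F by (metis card.empty of_nat_0)
    then show ?thesis
      using B(1)[of _ i j] by force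
  qed
  have val: "val (F $ i $ j) = - M $ i $ j" for i j
    using nz low by (rule val_eqI)
  have "row i F = (\<Sum>l<k. pmonom 1 (- B i l) *s (\<chi> j. pmonom 1 (- C l j)))" for i
    unfolding F_def row_def by (simp add: vec_eq_iff)
  then have "rows F \<subseteq> vec.span ((\<lambda>l. \<chi> j. pmonom 1 (- C l j)) ` {..<k})"
    unfolding rows_def by (auto intro!: vec.span_sum vec.span_scale intro: vec.span_base)
  then have "rank F \<le> card ((\<lambda>l. \<chi> j. pmonom 1 (- C l j) :: pseries^'n) ` {..<k})"
    unfolding row_rank_def_gen by (intro vec.dim_le_card) auto
  also have "\<dots> \<le> k"
    using card_image_le[of "{..<k}"] by auto
  finally have "rank F \<le> k" .
  moreover have "F $ i $ j \<noteq> 0" for i j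
    using nz[of i j] by (auto simp: coeff_simps)
  ultimately show thesis
    using that[of F] val by simp
qed

lemma kapranov_rank_eq:
  fixes M :: "real^'n^'n"
  assumes minor: "dominant_minor M K r c a b" and factors: "factors_through (card K) M"
    and "finite K"
  shows "kapranov_rank M = card K"
proof -
  have lower: "card K \<le> rank F"
    if "\<And>i j. F $ i $ j \<noteq> 0 \<and> - val (F $ i $ j) = M $ i $ j" for F :: "pseries^'n^'n"
  proof (rule ccontr)
    assume "\<not> card K \<le> rank F"
    then obtain \<beta> where \<beta>: "\<exists>i\<in>K. \<beta> i \<noteq> 0" "\<And>j. (\<Sum>i\<in>K. \<beta> i * F $ r i $ j) = 0"
      using rows_dependent_of_rank_less[OF \<open>finite K\<close>, of F r] by (metis not_le)
    then show False
      using dominant_minor_lift_independent[OF minor \<open>finite K\<close>, of F \<beta>] that by blast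
  qed
  obtain F :: "pseries^'n^'n" where F: "\<And>i j. F $ i $ j \<noteq> 0" "\<And>i j. - val (F $ i $ j) = M $ i $ j"
    "rank F \<le> card K"
    using ex_lift_rank_le[OF factors] by blast
  then have "rank F = card K"
    using lower[of F] by simp
  with F show ?thesis
    unfolding kapranov_rank_def using lower by (intro Least_equality) blast+
qed

section \<open>Dimension of the column space\<close>

text \<open>\<open>f\<close> is a homeomorphism onto its image with inverse \<open>g\<close>, and
  the dimension is a topological invariant.\<close>

lemma dim_le_image_iff:
  assumes "continuous_on S f" "continuous_on (f ` S) g" "\<And>x. x \<in> S \<Longrightarrow> g (f x) = x"
  shows "top_of_set (f ` S) dim_le n \<longleftrightarrow> top_of_set S dim_le n"
proof -
  have "homeomorphic_maps (top_of_set S) (top_of_set (f ` S)) f g"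
    unfolding homeomorphic_maps_def using assms by (auto simp: continuous_map_subtopology_eu)
  then show ?thesis
    using homeomorphic_space_dimension_le homeomorphic_space_def by blast
qed

lemma continuous_on_MAX:
  fixes f :: "'i \<Rightarrow> 'a::topological_space \<Rightarrow> real"
  assumes "finite K" "K \<noteq> {}" "\<And>l. l \<in> K \<Longrightarrow> continuous_on A (f l)"
  shows "continuous_on A (\<lambda>x. MAX l\<in>K. f l x)"
  using assms by (induction K rule: finite_ne_induct) (auto intro!: continuous_on_max)

context regular_generators
begin

text \<open>A copy of \<open>card K\<close>-dimensional space inside \<open>real^'n\<close>, as the
  set \<open>K\<close> is not an index type.\<close>

definition coordinates :: "(real^'n) set" where
  "coordinates = {y. \<forall>l. l \<notin> K \<longrightarrow> y $ l = 0}"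

definition to_coordinates :: "real^'n \<Rightarrow> real^'n" where
  "to_coordinates x = (\<chi> l. if l \<in> K then D x l else 0)"

definition of_coordinates :: "real^'n \<Rightarrow> real^'n" where
  "of_coordinates y = trop_comb K g (\<lambda>l. y $ l)"

lemma subspace_coordinates: "subspace coordinates"
  unfolding coordinates_def subspace_def by simp

lemma dim_coordinates: "dim coordinates = card K"
  unfolding coordinates_def using dim_substandard_cart[where 'a = real and d = K]
  by (simp add: dim_vec_eq)

lemma continuous_on_to_coordinates: "continuous_on A to_coordinates"
proof -
  have "continuous_on A (\<lambda>x. D x l)" for l
    unfolding D_def by (intro continuous_on_MAX continuous_intros) auto
  then have "continuous_on A (\<lambda>x. if l \<in> K then D x l else 0)" for l
    by (cases "l \<in> K") auto
  then show ?thesis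
    unfolding to_coordinates_def by (intro continuous_on_vec_lambda)
qed

lemma continuous_on_of_coordinates: "continuous_on A of_coordinates"
  unfolding of_coordinates_def trop_comb_def
  by (intro continuous_on_vec_lambda continuous_on_MAX continuous_intros) (use K_nonempty in auto)

lemma of_to_coordinates: "x \<in> column_space N \<Longrightarrow> of_coordinates (to_coordinates x) = x"
  using trop_comb_D[of x] unfolding of_coordinates_def to_coordinates_def trop_comb_def
  by (simp cong: image_cong)

lemma column_space_dim_le: "top_of_set (column_space N) dim_le int (card K)"
proof -
  have "affine coordinates"
    using subspace_coordinates by (rule subspace_imp_affine)
  then have "top_of_set coordinates dim_le int (card K)"
    by (rule affine_dim_le) (simp add: aff_dim_subspace subspace_coordinates dim_coordinates)
  moreover have "to_coordinates ` column_space N \<subseteq> coordinates"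
    unfolding to_coordinates_def coordinates_def by auto
  ultimately have "top_of_set (to_coordinates ` column_space N) dim_le int (card K)"
    by (rule dimension_le_subtopologies)
  then show ?thesis
    using dim_le_image_iff[OF continuous_on_to_coordinates continuous_on_of_coordinates
        of_to_coordinates] by blast
qed

text \<open>
  Near the point \<open>- u\<close> the map \<open>of_coordinates\<close> is inverted by \<open>to_coordinates\<close>, so the column
  space contains a copy of a ball of dimension \<open>card K\<close>.
\<close>

lemma column_space_dim_le_imp:
  assumes "top_of_set (column_space N) dim_le n"
  shows "int (card K) \<le> n"
proof (rule ccontr)
  assume "\<not> int (card K) \<le> n"
  define X where "X = (\<lambda>(i, j). u j - u i - D (g j) i) ` {(i, j). i \<in> K \<and> j \<in> K \<and> i \<noteq> j}"
  \<comment> \<open>Half of the least slack in \<open>D (g j) i < u j - u i\<close>, so that two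
    coordinates may each move by \<open>e\<close>. The 1 keeps the set nonempty when
    \<open>K\<close> is a singleton.\<close>
  define e where "e = Min (insert 1 X) / 2"
  have "finite X"
    unfolding X_def by (rule finite_imageI) (rule finite)
  have "0 < x" if "x \<in> insert 1 X" for x
    using that D_gen_less unfolding X_def by auto
  then have "0 < e"
    unfolding e_def using \<open>finite X\<close> Min_in[of "insert 1 X"] by auto
  have e: "D (g j) i + 2 * e \<le> u j - u i" if "i \<in> K" "j \<in> K" "i \<noteq> j" for i j
  proof -
    have "u j - u i - D (g j) i \<in> X"
      unfolding X_def using that by (intro image_eqI[of _ _ "(i, j)"]) auto
    then have "2 * e \<le> u j - u i - D (g j) i"
      unfolding e_def using \<open>finite X\<close> Min_le[of "insert 1 X"] by auto
    then show ?thesis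
      by simp
  qed
  define p :: "real^'n" where "p = (\<chi> l. if l \<in> K then - u l else 0)"
  define Y where "Y = coordinates \<inter> cball p e"
  have inverse: "to_coordinates (of_coordinates y) = y" if "y \<in> Y" for y
  proof -
    have near: "\<bar>y $ l + u l\<bar> \<le> e" if "l \<in> K" for l
    proof -
      have "\<bar>(y - p) $ l\<bar> \<le> norm (y - p)"
        by (rule component_le_norm_cart)
      also have "\<dots> \<le> e"
        using \<open>y \<in> Y\<close> unfolding Y_def by (simp add: dist_norm norm_minus_commute)
      finally show ?thesis
        using that unfolding p_def by simp
    qed
    have "D (of_coordinates y) i = y $ i" if i: "i \<in> K" for i
      unfolding of_coordinates_def
    proof (rule D_trop_comb[OF i])
      fix j assume j: "j \<in> K"
      show "D (g j) i + y $ j \<le> y $ i"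
      proof (cases "i = j")
        case True
        then show ?thesis
          using D_gen_self[OF j] by simp
      next
        case False
        then show ?thesis
          using e[OF i j] near[OF i] near[OF j] by linarith
      qed
    qed
    moreover have "y $ l = 0" if "l \<notin> K" for l
      using \<open>y \<in> Y\<close> that unfolding Y_def coordinates_def by simp
    ultimately show ?thesis
      unfolding to_coordinates_def by (simp add: vec_eq_iff)
  qed
  have "of_coordinates ` Y \<subseteq> column_space N"
    unfolding column_space_eq of_coordinates_def by auto
  then have "top_of_set (of_coordinates ` Y) dim_le n"
    by (rule dimension_le_subtopologies[OF assms])
  then have "top_of_set Y dim_le n"
    using dim_le_image_iff[OF continuous_on_of_coordinates continuous_on_to_coordinates inverse]
    by blast
  moreover have "p \<in> coordinates"
    unfolding p_def coordinates_def by simp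
  ultimately show False
    using not_dim_le_cball[OF subspace_coordinates _ \<open>0 < e\<close>, of p n] \<open>\<not> int (card K) \<le> n\<close>
    unfolding Y_def dim_coordinates by simp
qed

end

section \<open>Comparison of the ranks\<close>

lemma regular_column_rank:
  fixes N :: "real^'n^'n"
  assumes "von_neumann_regular N"
  obtains K :: "'n set" and r c a b where "card K = column_generator_rank N"
    "dominant_minor N K r c a b" "factors_through (card K) N"
    "\<And>n. top_of_set (column_space N) dim_le n \<longleftrightarrow> int (card K) \<le> n"
proof -
  obtain B where B: "N \<otimes>\<^sub>T B \<otimes>\<^sub>T N = N"
    using assms unfolding von_neumann_regular_def by blast
  obtain K :: "'n set" and g where K: "K \<noteq> {}" "card K = column_generator_rank N"
    "trop_span (g ` K) = column_space N" "\<And>j. j \<in> K \<Longrightarrow> g j \<notin> trop_span (g ` (K - {j}))"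
    using irredundant_generators[of N] by metis
  interpret regular_generators N B K g
    by unfold_locales (use B K in auto)
  obtain r c a b where minor: "dominant_minor N K r c a b"
    using ex_dominant_minor by blast
  have "top_of_set (column_space N) dim_le n \<longleftrightarrow> int (card K) \<le> n" for n
    using column_space_dim_le_imp dimension_le_mono[OF column_space_dim_le] by blast
  then show thesis
    by (rule that[OF K(2) minor factors_through_card])
qed

lemma row_space_eq: "row_space M = column_space (transpose M)"
  unfolding row_space_def column_space_def columns_transpose ..

lemma row_generator_rank_eq: "row_generator_rank M = column_generator_rank (transpose M)"
  unfolding row_generator_rank_def column_generator_rank_def row_space_eq ..

lemma gondran_minoux_column_rank_eq:
  "gondran_minoux_column_rank M = gondran_minoux_row_rank (transpose M)"
  unfolding gondran_minoux_column_rank_def gondran_minoux_row_rank_def row_transpose ..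

theorem corollary1p3:
  fixes M :: "real^'n^'n"
  assumes "von_neumann_regular M"
  shows "row_generator_rank M = column_generator_rank M
    \<and> column_generator_rank M = tropical_rank M
    \<and> tropical_rank M = factor_rank M
    \<and> factor_rank M = gondran_minoux_row_rank M
    \<and> gondran_minoux_row_rank M = gondran_minoux_column_rank M
    \<and> gondran_minoux_column_rank M = determinantal_rank M
    \<and> determinantal_rank M = kapranov_rank M"
proof -
  obtain K :: "'n set" and r c a b where K: "card K = column_generator_rank M"
    and minor: "dominant_minor M K r c a b" and factors: "factors_through (card K) M"
    using regular_column_rank[OF assms] by metis
  obtain K' :: "'n set" and r' c' a' b' where K': "card K' = row_generator_rank M"
    and minor': "dominant_minor (transpose M) K' r' c' a' b'"
    and factors': "factors_through (card K') (transpose M)"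
    and dim: "\<And>n. top_of_set (row_space M) dim_le n \<longleftrightarrow> int (card K') \<le> n"
    using regular_column_rank[OF von_neumann_regular_transpose[OF assms]]
    unfolding row_generator_rank_eq row_space_eq by metis
  \<comment> \<open>Up to transposition, the minor found for each of \<open>M\<close> and its
    transpose is compared with the factorization found for the other, which gives both
    inequalities.\<close>
  have "card K \<le> card K'"
    using card_dominant_minor_le[OF dominant_minor_transpose[OF minor] factors'] .
  moreover have "card K' \<le> card K"
    using card_dominant_minor_le[OF minor' factors_through_transpose[OF factors]] .
  ultimately have card: "card K' = card K"
    by simp
  have "tropical_rank M = card K"
    unfolding tropical_rank_def dim card by (rule Least_equality) auto
  moreover have "factor_rank M = card K" "determinantal_rank M = card K" "kapranov_rank M = card K"
    using factor_rank_eq[OF minor factors] determinantal_rank_eq[OF minor factors finite]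
      kapranov_rank_eq[OF minor factors finite] by simp_all
  moreover have "gondran_minoux_row_rank M = card K"
    by (rule gondran_minoux_row_rank_eq[OF minor factors])
  moreover have "gondran_minoux_column_rank M = card K"
    using gondran_minoux_row_rank_eq[OF minor' factors']
    unfolding gondran_minoux_column_rank_eq card .
  ultimately show ?thesis
    using K K' card by simp
qed

end
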